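(* Let $M$ be a closed connected oriented three-manifold, let $\kappa>0$, and let $(g,\varphi,f)$ be a three-dimensional Heterotic soliton on $M$ with parameter $\kappa$. If the Riemannian metric $g$ is Einstein, then the function $f$ (the dilaton) is constant.
   Context: Notation: for a Riemannian metric $g$, $\mathrm{Ric}^g$ is the Ricci tensor, $s_g$ the scalar curvature, $\nabla^g$ the Levi-Civita connection, $\ast_g$ the Hodge star, $\delta^g$ the codifferential (formal adjoint of $\mathrm{d}$). $(\mathrm{Ric}^g\circ_g\mathrm{Ric}^g)(v_1,v_2):=g(\mathrm{Ric}^g(v_1),\mathrm{Ric}^g(v_2))$ and $|\mathrm{Ric}^g|_g^2$ is its trace. $[\ast_g\mathrm{d}f,\mathrm{Ric}^g]$ is the commutator of endomorphisms, where a two-form $\omega$ is viewed as the endomorphism $v\mapsto (v\lrcorner\omega)^{\sharp_g}$ and $\mathrm{Ric}^g$ as an endomorphism via $g$; the commutator is then viewed as a symmetric bilinear form via $g$. A three-dimensional Heterotic soliton with parameter $\kappa>0$ is a triple $(g,\varphi,f)$, with $g$ a Riemannian metric, $\varphi$ a closed one-form and $f$ a smooth function on $M$, satisfying $$-\kappa\,\mathrm{Ric}^g\circ_g\mathrm{Ric}^g+\Big(1+\kappa s_g-\frac{\kappa}{2}f^2\Big)\mathrm{Ric}^g+\Big(\kappa|\mathrm{Ric}^g|_g^2-\frac{\kappa}{2}s_g^2+\frac{\kappa}{4}|\mathrm{d}f|_g^2-\frac12 f^2+\frac{\kappa}{8}f^4\Big)g+\frac{\kappa}{2}[\ast_g\mathrm{d}f,\mathrm{Ric}^g]+\frac{\kappa}{4}\mathrm{d}f\otimes\mathrm{d}f+\nabla^g\varphi=0,$$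 $$f\varphi=\mathrm{d}f,\qquad s_g=3\,\delta^g\varphi+2|\varphi|_g^2-\frac12f^2 .$$ *)

theory Defs
  imports "HOL-Analysis.Analysis"
begin

section \<open>Smooth maps on open subsets of Euclidean space\<close>

primrec Ck_on :: "nat \<Rightarrow> 'a::euclidean_space set \<Rightarrow> ('a \<Rightarrow> 'b::real_normed_vector) \<Rightarrow> bool" where
  "Ck_on 0 S F \<longleftrightarrow> continuous_on S F"
| "Ck_on (Suc k) S F \<longleftrightarrow>
     (\<forall>x\<in>S. F differentiable (at x)) \<and>
     (\<forall>b\<in>Basis. Ck_on k S (\<lambda>x. frechet_derivative F (at x) b))"

text \<open>Only meant for open \<open>S\<close>.\<close>

definition smooth_on :: "'a::euclidean_space set \<Rightarrow> ('a \<Rightarrow> 'b::real_normed_vector) \<Rightarrow> bool" where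
  "smooth_on S F \<longleftrightarrow> (\<forall>k. Ck_on k S F)"


section \<open>Oriented smooth three-manifolds\<close>

text \<open>A chart is a pair of a domain and a coordinate map; the values of the coordinate map outside
  the domain are irrelevant.  A smooth oriented structure is given by an atlas, not necessarily
  maximal, whose transition maps are smooth with positive Jacobian determinant.\<close>

type_synonym 'a chart = "'a set \<times> ('a \<Rightarrow> real^3)"

definition chart_dom :: "'a chart \<Rightarrow> 'a set" where
  "chart_dom c = fst c"

definition chart_map :: "'a chart \<Rightarrow> 'a \<Rightarrow> real^3" where
  "chart_map c = snd c"

definition chart_inv :: "'a chart \<Rightarrow> real^3 \<Rightarrow> 'a" where
  "chart_inv c = inv_into (chart_dom c) (chart_map c)"

definition is_chart :: "'a topology \<Rightarrow> 'a chart \<Rightarrow> bool" where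
  "is_chart M c \<longleftrightarrow>
     openin M (chart_dom c) \<and> open (chart_map c ` chart_dom c) \<and>
     homeomorphic_map (subtopology M (chart_dom c))
       (top_of_set (chart_map c ` chart_dom c)) (chart_map c)"

text \<open>\<open>jacobian c d p $ i $ j\<close> is the derivative of the \<open>i\<close>-th coordinate of \<open>d\<close> with respect to the
  \<open>j\<close>-th coordinate of \<open>c\<close>.\<close>

definition jacobian :: "'a chart \<Rightarrow> 'a chart \<Rightarrow> 'a \<Rightarrow> real^3^3" where
  "jacobian c d p = matrix (frechet_derivative (chart_map d \<circ> chart_inv c) (at (chart_map c p)))"

definition oriented_atlas :: "'a topology \<Rightarrow> 'a chart set \<Rightarrow> bool" where
  "oriented_atlas M A \<longleftrightarrow>
     (\<forall>c\<in>A. is_chart M c) \<and>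
     (\<Union>c\<in>A. chart_dom c) = topspace M \<and>
     (\<forall>c\<in>A. \<forall>d\<in>A.
        smooth_on (chart_map c ` (chart_dom c \<inter> chart_dom d)) (chart_map d \<circ> chart_inv c) \<and>
        (\<forall>p\<in>chart_dom c \<inter> chart_dom d. det (jacobian c d p) > 0))"

definition oriented_three_manifold :: "'a topology \<Rightarrow> 'a chart set \<Rightarrow> bool" where
  "oriented_three_manifold M A \<longleftrightarrow>
     Hausdorff_space M \<and> second_countable M \<and> oriented_atlas M A"

text \<open>Charts take values in open subsets of \<open>\<real>\<^sup>3\<close>, so there is no boundary and a closed
  manifold is a compact one.\<close>

definition closed_oriented_three_manifold :: "'a topology \<Rightarrow> 'a chart set \<Rightarrow> bool" where
  "closed_oriented_three_manifold M A \<longleftrightarrow> oriented_three_manifold M A \<and> compact_space M"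


section \<open>Functions and covariant tensor fields\<close>

text \<open>A tensor field is given by its components in every chart of the atlas, which are functions on
  the manifold that obey the tensorial transformation law on overlaps.  Component functions are
  unconstrained outside the domain of the chart.\<close>

type_synonym 'a covector_field = "'a chart \<Rightarrow> 'a \<Rightarrow> real^3"
type_synonym 'a bilinear_field = "'a chart \<Rightarrow> 'a \<Rightarrow> real^3^3"

definition smooth_in_chart :: "'a chart \<Rightarrow> ('a \<Rightarrow> 'b::real_normed_vector) \<Rightarrow> bool" where
  "smooth_in_chart c F \<longleftrightarrow> smooth_on (chart_map c ` chart_dom c) (F \<circ> chart_inv c)"

definition smooth_function :: "'a chart set \<Rightarrow> ('a \<Rightarrow> real) \<Rightarrow> bool" where
  "smooth_function A f \<longleftrightarrow> (\<forall>c\<in>A. smooth_in_chart c f)"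

definition one_form :: "'a chart set \<Rightarrow> 'a covector_field \<Rightarrow> bool" where
  "one_form A \<phi> \<longleftrightarrow>
     (\<forall>c\<in>A. smooth_in_chart c (\<phi> c)) \<and>
     (\<forall>c\<in>A. \<forall>d\<in>A. \<forall>p\<in>chart_dom c \<inter> chart_dom d.
        \<phi> c p = transpose (jacobian c d p) *v \<phi> d p)"

definition riemannian_metric :: "'a chart set \<Rightarrow> 'a bilinear_field \<Rightarrow> bool" where
  "riemannian_metric A g \<longleftrightarrow>
     (\<forall>c\<in>A. smooth_in_chart c (g c)) \<and>
     (\<forall>c\<in>A. \<forall>d\<in>A. \<forall>p\<in>chart_dom c \<inter> chart_dom d.
        g c p = transpose (jacobian c d p) ** g d p ** jacobian c d p) \<and>
     (\<forall>c\<in>A. \<forall>p\<in>chart_dom c.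
        transpose (g c p) = g c p \<and> (\<forall>v. v \<noteq> 0 \<longrightarrow> v \<bullet> (g c p *v v) > 0))"

text \<open>\<open>partial c i F\<close> is the derivative of \<open>F\<close> along the \<open>i\<close>-th coordinate vector field of \<open>c\<close>.\<close>

definition partial :: "'a chart \<Rightarrow> 3 \<Rightarrow> ('a \<Rightarrow> real) \<Rightarrow> 'a \<Rightarrow> real" where
  "partial c i F p = frechet_derivative (F \<circ> chart_inv c) (at (chart_map c p)) (axis i 1)"

definition differential :: "('a \<Rightarrow> real) \<Rightarrow> 'a covector_field" where
  "differential f c p = (\<chi> i. partial c i f p)"

definition ext_deriv1 :: "'a covector_field \<Rightarrow> 'a bilinear_field" where
  "ext_deriv1 \<phi> c p =
     (\<chi> i j. partial c i (\<lambda>q. \<phi> c q $ j) p - partial c j (\<lambda>q. \<phi> c q $ i) p)"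

definition closed_one_form :: "'a chart set \<Rightarrow> 'a covector_field \<Rightarrow> bool" where
  "closed_one_form A \<phi> \<longleftrightarrow>
     one_form A \<phi> \<and> (\<forall>c\<in>A. \<forall>p\<in>chart_dom c. ext_deriv1 \<phi> c p = 0)"

definition tensor_square :: "'a covector_field \<Rightarrow> 'a bilinear_field" where
  "tensor_square \<alpha> c p = (\<chi> i j. \<alpha> c p $ i * \<alpha> c p $ j)"


section \<open>Metric contractions\<close>

definition sharp :: "'a bilinear_field \<Rightarrow> 'a covector_field \<Rightarrow> 'a chart \<Rightarrow> 'a \<Rightarrow> real^3" where
  "sharp g \<alpha> c p = matrix_inv (g c p) *v \<alpha> c p"

definition form_inner ::
    "'a bilinear_field \<Rightarrow> 'a covector_field \<Rightarrow> 'a covector_field \<Rightarrow> 'a chart \<Rightarrow> 'a \<Rightarrow> real" where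
  "form_inner g \<alpha> \<beta> c p = \<alpha> c p \<bullet> sharp g \<beta> c p"

text \<open>The endomorphism \<open>v \<mapsto> h(v, -)\<^sup>\<sharp>\<close> attached to a bilinear form \<open>h\<close>, and the inverse operation,
  which sends an endomorphism \<open>E\<close> to the bilinear form \<open>g(E -, -)\<close>.\<close>

definition endo_of :: "'a bilinear_field \<Rightarrow> 'a bilinear_field \<Rightarrow> 'a chart \<Rightarrow> 'a \<Rightarrow> real^3^3" where
  "endo_of g h c p = matrix_inv (g c p) ** transpose (h c p)"

definition form_of_endo ::
    "'a bilinear_field \<Rightarrow> ('a chart \<Rightarrow> 'a \<Rightarrow> real^3^3) \<Rightarrow> 'a bilinear_field" where
  "form_of_endo g E c p = transpose (E c p) ** g c p"

definition metric_trace :: "'a bilinear_field \<Rightarrow> 'a bilinear_field \<Rightarrow> 'a chart \<Rightarrow> 'a \<Rightarrow> real" where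
  "metric_trace g h c p = trace (endo_of g h c p)"

text \<open>The form \<open>(v, w) \<mapsto> g(h(v), h(w))\<close>, with \<open>h\<close> viewed as an endomorphism.\<close>

definition form_comp :: "'a bilinear_field \<Rightarrow> 'a bilinear_field \<Rightarrow> 'a bilinear_field" where
  "form_comp g h c p = transpose (endo_of g h c p) ** g c p ** endo_of g h c p"

definition form_commutator ::
    "'a bilinear_field \<Rightarrow> 'a bilinear_field \<Rightarrow> 'a bilinear_field \<Rightarrow> 'a bilinear_field" where
  "form_commutator g h k =
     form_of_endo g (\<lambda>c p. endo_of g h c p ** endo_of g k c p - endo_of g k c p ** endo_of g h c p)"


section \<open>Levi-Civita connection and curvature\<close>

text \<open>\<open>christoffel g c p k i j\<close> is the \<open>k\<close>-th component of the covariant derivative of the \<open>j\<close>-th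
  coordinate field along the \<open>i\<close>-th one.\<close>

definition christoffel :: "'a bilinear_field \<Rightarrow> 'a chart \<Rightarrow> 'a \<Rightarrow> 3 \<Rightarrow> 3 \<Rightarrow> 3 \<Rightarrow> real" where
  "christoffel g c p k i j =
     (\<Sum>l\<in>UNIV. matrix_inv (g c p) $ k $ l *
        (partial c i (\<lambda>q. g c q $ j $ l) p + partial c j (\<lambda>q. g c q $ i $ l) p
         - partial c l (\<lambda>q. g c q $ i $ j) p)) / 2"

definition cov_deriv :: "'a bilinear_field \<Rightarrow> 'a covector_field \<Rightarrow> 'a bilinear_field" where
  "cov_deriv g \<phi> c p =
     (\<chi> i j. partial c i (\<lambda>q. \<phi> c q $ j) p - (\<Sum>k\<in>UNIV. christoffel g c p k i j * \<phi> c p $ k))"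

text \<open>\<open>riemann g c p l i j k\<close> is the \<open>l\<close>-th component of
  \<open>R(\<partial>\<^sub>i, \<partial>\<^sub>j) \<partial>\<^sub>k\<close>, where \<open>R(X, Y) = [\<nabla>\<^sub>X, \<nabla>\<^sub>Y] - \<nabla>\<^bsub>[X, Y]\<^esub>\<close>;
  the Ricci tensor is \<open>Ric(Y, Z) = tr (X \<mapsto> R(X, Y) Z)\<close>, which is positive on round spheres.\<close>

definition riemann :: "'a bilinear_field \<Rightarrow> 'a chart \<Rightarrow> 'a \<Rightarrow> 3 \<Rightarrow> 3 \<Rightarrow> 3 \<Rightarrow> 3 \<Rightarrow> real" where
  "riemann g c p l i j k =
     partial c i (\<lambda>q. christoffel g c q l j k) p - partial c j (\<lambda>q. christoffel g c q l i k) p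
     + (\<Sum>m\<in>UNIV. christoffel g c p l i m * christoffel g c p m j k
                - christoffel g c p l j m * christoffel g c p m i k)"

definition ricci :: "'a bilinear_field \<Rightarrow> 'a bilinear_field" where
  "ricci g c p = (\<chi> j k. \<Sum>i\<in>UNIV. riemann g c p i i j k)"

definition scalar_curvature :: "'a bilinear_field \<Rightarrow> 'a chart \<Rightarrow> 'a \<Rightarrow> real" where
  "scalar_curvature g = metric_trace g (ricci g)"

definition einstein :: "'a chart set \<Rightarrow> 'a bilinear_field \<Rightarrow> bool" where
  "einstein A g \<longleftrightarrow> (\<exists>\<Lambda>::real. \<forall>c\<in>A. \<forall>p\<in>chart_dom c. ricci g c p = \<Lambda> *\<^sub>R g c p)"


section \<open>Hodge star and codifferential\<close>

text \<open>The Hodge star of a one-form is the contraction of the Riemannian volume form with the dual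
  vector field.  It depends on the orientation, for the volume form has component \<open>+ sqrt (det g)\<close>
  in the (positively oriented) charts of the atlas.\<close>

definition hodge1 :: "'a bilinear_field \<Rightarrow> 'a covector_field \<Rightarrow> 'a bilinear_field" where
  "hodge1 g \<alpha> c p =
     (\<chi> i j. sqrt (det (g c p)) * det (vector [sharp g \<alpha> c p, axis i 1, axis j 1] :: real^3^3))"

text \<open>Three-forms are represented by their component on \<open>(\<partial>\<^sub>1, \<partial>\<^sub>2, \<partial>\<^sub>3)\<close>.\<close>

definition ext_deriv2 :: "'a bilinear_field \<Rightarrow> 'a chart \<Rightarrow> 'a \<Rightarrow> real" where
  "ext_deriv2 \<omega> c p =
     partial c 1 (\<lambda>q. \<omega> c q $ 2 $ 3) p + partial c 2 (\<lambda>q. \<omega> c q $ 3 $ 1) p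
     + partial c 3 (\<lambda>q. \<omega> c q $ 1 $ 2) p"

definition hodge3 :: "'a bilinear_field \<Rightarrow> ('a chart \<Rightarrow> 'a \<Rightarrow> real) \<Rightarrow> 'a chart \<Rightarrow> 'a \<Rightarrow> real" where
  "hodge3 g \<tau> c p = \<tau> c p / sqrt (det (g c p))"

text \<open>On one-forms of a Riemannian three-manifold the formal adjoint of \<open>d\<close> is \<open>- \<star> d \<star>\<close>
  (see \<open>codifferential_formal_adjoint\<close> below).\<close>

definition codifferential :: "'a bilinear_field \<Rightarrow> 'a covector_field \<Rightarrow> 'a chart \<Rightarrow> 'a \<Rightarrow> real" where
  "codifferential g \<phi> c p = - hodge3 g (ext_deriv2 (hodge1 g \<phi>)) c p"


section \<open>Three-dimensional Heterotic solitons\<close>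

definition heterotic_soliton ::
    "'a chart set \<Rightarrow> real \<Rightarrow> 'a bilinear_field \<Rightarrow> 'a covector_field \<Rightarrow> ('a \<Rightarrow> real) \<Rightarrow> bool" where
  "heterotic_soliton A \<kappa> g \<phi> f \<longleftrightarrow>
     riemannian_metric A g \<and> closed_one_form A \<phi> \<and> smooth_function A f \<and>
     (\<forall>c\<in>A. \<forall>p\<in>chart_dom c.
        let s = scalar_curvature g c p in
          - \<kappa> *\<^sub>R form_comp g (ricci g) c p
          + (1 + \<kappa> * s - \<kappa> / 2 * (f p)\<^sup>2) *\<^sub>R ricci g c p
          + (\<kappa> * metric_trace g (form_comp g (ricci g)) c p - \<kappa> / 2 * s\<^sup>2
             + \<kappa> / 4 * form_inner g (differential f) (differential f) c p
             - 1 / 2 * (f p)\<^sup>2 + \<kappa> / 8 * (f p) ^ 4) *\<^sub>R g c p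
          + (\<kappa> / 2) *\<^sub>R form_commutator g (hodge1 g (differential f)) (ricci g) c p
          + (\<kappa> / 4) *\<^sub>R tensor_square (differential f) c p
          + cov_deriv g \<phi> c p = 0 \<and>
          f p *\<^sub>R \<phi> c p = differential f c p \<and>
          s = 3 * codifferential g \<phi> c p + 2 * form_inner g \<phi> \<phi> c p - 1 / 2 * (f p)\<^sup>2)"


section \<open>Consistency of the coordinate formulas\<close>

text \<open>The Christoffel symbols define the Levi-Civita connection, \<open>endo_of\<close> is characterised by
  \<open>g(endo_of h v, w) = h(v, w)\<close>, and \<open>codifferential\<close> is the formal adjoint of \<open>d\<close>.\<close>

lemma det_pos_if_posdef:
  fixes B :: "real^3^3"
  assumes "\<And>v. v \<noteq> 0 \<Longrightarrow> v \<bullet> (B *v v) > 0"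
  shows "det B > 0"
proof -
  define P where "P t = (1 - t) *\<^sub>R mat 1 + t *\<^sub>R B" for t :: real
  have nz: "det (P t) \<noteq> 0" if t: "0 \<le> t" "t \<le> 1" for t
  proof -
    have "P t *v v \<noteq> 0" if "v \<noteq> 0" for v
    proof -
      have "v \<bullet> (P t *v v) = (1 - t) * (v \<bullet> v) + t * (v \<bullet> (B *v v))"
        by (simp add: P_def matrix_vector_mult_add_rdistrib scaleR_matrix_vector_assoc[symmetric]
            inner_add_right)
      moreover have "(1 - t) * (v \<bullet> v) \<ge> 0" "t * (v \<bullet> (B *v v)) \<ge> 0"
        using t assms[OF that] by auto
      moreover have "(1 - t) * (v \<bullet> v) > 0 \<or> t * (v \<bullet> (B *v v)) > 0"
        using t assms[OF that] that by (cases "t = 1") auto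
      ultimately have "v \<bullet> (P t *v v) > 0" by linarith
      then show ?thesis by auto
    qed
    then have "\<forall>x. P t *v x = 0 \<longrightarrow> x = 0" by blast
    then have "invertible (P t)"
      using matrix_left_invertible_ker[of "P t"] invertible_left_inverse by blast
    then show ?thesis by (simp add: invertible_det_nz)
  qed
  have cont: "continuous_on {0..1} (\<lambda>t. det (P t))"
    unfolding P_def det_3 by (simp add: mat_def) (intro continuous_intros)
  have "det (P 0) = 1" by (simp add: P_def)
  have "det (P 1) > 0"
  proof (rule ccontr)
    assume "\<not> det (P 1) > 0"
    then have "\<exists>t. 0 \<le> t \<and> t \<le> 1 \<and> det (P t) = 0"
      using IVT2'[of "\<lambda>t. det (P t)" 1 0 0] cont \<open>det (P 0) = 1\<close> by auto
    then show False using nz by auto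
  qed
  then show ?thesis by (simp add: P_def)
qed

lemma integral_derivative_compact_support:
  fixes F :: "'a::euclidean_space \<Rightarrow> real"
  assumes der: "\<And>x. (F has_derivative (\<lambda>h. D x \<bullet> h)) (at x)"
    and cont: "continuous_on UNIV D"
    and K: "compact K" and supp: "\<And>x. x \<notin> K \<Longrightarrow> F x = 0"
  shows "(LINT x|lborel. D x \<bullet> b) = 0"
proof -
  have contF: "continuous_on UNIV F"
    by (intro continuous_at_imp_continuous_on ballI has_derivative_continuous[OF der])
  obtain r where "r > 0" "\<forall>x\<in>K. norm x \<le> r"
    using compact_imp_bounded[OF K] unfolding bounded_pos by blast
  then have r: "K \<subseteq> cball 0 r" "r > 0" by auto
  define R where "R = r + norm b"
  have "compact ((\<lambda>x. norm (D x)) ` cball 0 (R + norm b))"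
    by (intro compact_continuous_image continuous_intros continuous_on_subset[OF cont]) auto
  then have "bounded ((\<lambda>x. norm (D x)) ` cball 0 (R + norm b))" by (rule compact_imp_bounded)
  then obtain C where C: "\<And>x. x \<in> cball 0 (R + norm b) \<Longrightarrow> norm (D x) \<le> C"
    unfolding bounded_iff ball_simps real_norm_def abs_norm_cancel by blast
  define s where "s n x = real (Suc n) * (F (x + b /\<^sub>R real (Suc n)) - F x)" for n x
  have bm: "F \<in> borel_measurable borel"
    using contF by (simp add: borel_measurable_continuous_onI)
  have intF: "integrable lborel F"
  proof -
    have "integrable lborel (\<lambda>x. indicator (cball 0 r) x *\<^sub>R F x)"
      by (intro borel_integrable_compact continuous_on_subset[OF contF]) auto
    moreover have "(\<lambda>x. indicat_real (cball 0 r) x *\<^sub>R F x) = F"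
      using r supp by (force simp: indicator_def fun_eq_iff)
    ultimately show ?thesis by simp
  qed
  have intFs: "integrable lborel (\<lambda>x. F (x + c))" "(LINT x|lborel. F (x + c)) = (LINT x|lborel. F x)" for c
  proof -
    have d: "lborel = distr lborel borel ((+) c :: 'a \<Rightarrow> 'a)" by (rule lborel_distr_plus[symmetric])
    have e: "integrable (distr lborel borel ((+) c :: 'a \<Rightarrow> 'a)) F" using intF d by metis
    show "integrable lborel (\<lambda>x. F (x + c))"
      using e by (subst (asm) integrable_distr_eq) (auto simp: bm add.commute)
    have "(LINT x|lborel. F x) = (LINT x|distr lborel borel ((+) c :: 'a \<Rightarrow> 'a). F x)" using d by metis
    also have "\<dots> = (LINT x|lborel. F (c + x))" by (subst integral_distr) (auto simp: bm)
    finally show "(LINT x|lborel. F (x + c)) = (LINT x|lborel. F x)" by (simp add: add.commute)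
  qed
  have lim: "(\<lambda>n. LINT x|lborel. s n x) \<longlonglongrightarrow> (LINT x|lborel. D x \<bullet> b)"
  proof (rule integral_dominated_convergence[where w = "\<lambda>x. indicator (cball 0 R) x * (C * norm b)"])
    show "(\<lambda>x. D x \<bullet> b) \<in> borel_measurable lborel"
      using cont by (auto intro!: borel_measurable_continuous_onI continuous_intros)
    show "s n \<in> borel_measurable lborel" for n
      unfolding s_def using intFs(1) intF by (auto dest: borel_measurable_integrable)
    show "integrable lborel (\<lambda>x. indicator (cball 0 R) x * (C * norm b))"
      by (intro integrable_mult_left integrable_real_indicator) (use emeasure_lborel_cball_finite in auto)
    show "AE x in lborel. (\<lambda>n. s n x) \<longlonglongrightarrow> D x \<bullet> b"
    proof (rule AE_I2)
      fix x
      have "((\<lambda>t. F (x + t *\<^sub>R b)) has_derivative (\<lambda>t. D x \<bullet> (t *\<^sub>R b))) (at 0)"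
        by (rule has_derivative_compose[where g = F and f = "\<lambda>t. x + t *\<^sub>R b"])
           (auto intro!: derivative_eq_intros der[of "x + 0 *\<^sub>R b", simplified])
      then have "((\<lambda>t. F (x + t *\<^sub>R b)) has_real_derivative D x \<bullet> b) (at 0)"
        by (simp add: has_field_derivative_def mult_commute_abs)
      then have l: "((\<lambda>t. (F (x + t *\<^sub>R b) - F x) / t) \<longlongrightarrow> D x \<bullet> b) (at 0)"
        by (simp add: DERIV_def)
      have "filterlim (\<lambda>n. inverse (real (Suc n))) (at 0) sequentially"
        by (rule filterlim_atI[OF LIMSEQ_inverse_real_of_nat]) auto
      from filterlim_compose[OF l this]
      show "(\<lambda>n. s n x) \<longlonglongrightarrow> D x \<bullet> b"
        by (simp add: s_def divide_inverse mult.commute)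
    qed
    show "AE x in lborel. norm (s n x) \<le> indicator (cball 0 R) x * (C * norm b)" for n
    proof (rule AE_I2)
      fix x
      define t where "t = inverse (real (Suc n))"
      have t: "0 < t" "t \<le> 1" by (auto simp: t_def inverse_le_1_iff)
      show "norm (s n x) \<le> indicator (cball 0 R) x * (C * norm b)"
      proof (cases "x \<in> cball 0 R")
        case True
        have tb: "norm (u *\<^sub>R b) \<le> norm b" if "0 \<le> u" "u \<le> 1" for u
          using that by (simp add: mult_left_le_one_le)
        have "norm (F (x + t *\<^sub>R b) - F x) \<le> C * norm (x + t *\<^sub>R b - x)"
        proof (rule differentiable_bound[where S = "cball 0 (R + norm b)" and f' = "\<lambda>x h. D x \<bullet> h"])
          show "convex (cball (0::'a) (R + norm b))" by simp
          show "(F has_derivative (\<lambda>h. D x \<bullet> h)) (at x within cball 0 (R + norm b))" for x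
            using der has_derivative_at_withinI by blast
          show "onorm (\<lambda>h. D x \<bullet> h) \<le> C" if "x \<in> cball 0 (R + norm b)" for x
          proof (rule onorm_bound)
            show "0 \<le> C" using C[OF that] norm_ge_zero order.trans by blast
            show "norm (D x \<bullet> h) \<le> C * norm h" for h
              using order.trans[OF Cauchy_Schwarz_ineq2 mult_right_mono[OF C[OF that]], of h] by simp
          qed
          show "x \<in> cball 0 (R + norm b)" using True by (auto intro: order.trans)
          show "x + t *\<^sub>R b \<in> cball 0 (R + norm b)"
            using True tb[of t] t norm_triangle_ineq[of x "t *\<^sub>R b"] by (simp add: add_mono order.trans)
        qed
        then have "norm (F (x + t *\<^sub>R b) - F x) \<le> t * (C * norm b)"
          using t by (simp add: mult_ac)
        then have "inverse t * norm (F (x + t *\<^sub>R b) - F x) \<le> C * norm b"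
          using t by (simp add: field_simps)
        moreover have "s n x = inverse t * (F (x + t *\<^sub>R b) - F x)"
          by (simp add: s_def t_def)
        ultimately show ?thesis using True t by (simp add: abs_mult)
      next
        case False
        have "norm (t *\<^sub>R b) \<le> norm b" using t by (simp add: mult_left_le_one_le)
        then have "norm (x + t *\<^sub>R b) > r"
          using False norm_triangle_ineq4[of "x + t *\<^sub>R b" "t *\<^sub>R b"] by (simp add: R_def)
        moreover have "norm x > r" using False norm_ge_zero[of b] unfolding R_def mem_cball_0 by linarith
        ultimately have "F (x + t *\<^sub>R b) = 0" "F x = 0" using r supp
          by (metis mem_cball_0 not_less subsetD)+
        then show ?thesis using False by (simp add: s_def t_def)
      qed
    qed
  qed
  have "(LINT x|lborel. s n x) = 0" for n
    unfolding s_def using intFs intF by simp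
  then have "(\<lambda>n::nat. 0) \<longlonglongrightarrow> (LINT x|lborel. D x \<bullet> b)" using lim by simp
  then show ?thesis using LIMSEQ_unique tendsto_const by blast
qed

lemma chart_bij:
  assumes "is_chart M c"
  shows "inj_on (chart_map c) (chart_dom c)"
    and "chart_dom c \<subseteq> topspace M"
    and "p \<in> chart_dom c \<Longrightarrow> chart_inv c (chart_map c p) = p"
    and "x \<in> chart_map c ` chart_dom c \<Longrightarrow> chart_map c (chart_inv c x) = x"
    and "x \<in> chart_map c ` chart_dom c \<Longrightarrow> chart_inv c x \<in> chart_dom c"
proof -
  show d: "chart_dom c \<subseteq> topspace M" using assms openin_subset by (auto simp: is_chart_def)
  then have "topspace (subtopology M (chart_dom c)) = chart_dom c" by auto
  then show i: "inj_on (chart_map c) (chart_dom c)"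
    using assms homeomorphic_imp_injective_map unfolding is_chart_def by metis
  show "p \<in> chart_dom c \<Longrightarrow> chart_inv c (chart_map c p) = p"
    using i by (simp add: chart_inv_def)
  show "x \<in> chart_map c ` chart_dom c \<Longrightarrow> chart_map c (chart_inv c x) = x"
    by (simp add: chart_inv_def f_inv_into_f)
  show "x \<in> chart_map c ` chart_dom c \<Longrightarrow> chart_inv c x \<in> chart_dom c"
    by (simp add: chart_inv_def inv_into_into)
qed

lemma partial_eqI:
  assumes "((\<lambda>x. F (chart_inv c x)) has_derivative L) (at (chart_map c p))"
  shows "partial c i F p = L (axis i 1)"
  using frechet_derivative_at[OF assms] by (simp add: partial_def comp_def)

lemma partial_cong:
  assumes c: "is_chart M c" and p: "p \<in> chart_dom c"
    and eq: "\<And>q. q \<in> chart_dom c \<Longrightarrow> F q = G q"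
  shows "partial c i F p = partial c i G p"
proof -
  let ?V = "chart_map c ` chart_dom c"
  have V: "open ?V" "chart_map c p \<in> ?V" using c p by (auto simp: is_chart_def)
  have e: "(F \<circ> chart_inv c) x = (G \<circ> chart_inv c) x" if "x \<in> ?V" for x
    using eq chart_bij(5)[OF c that] by simp
  have "(F \<circ> chart_inv c has_derivative L) (at (chart_map c p)) \<longleftrightarrow>
        (G \<circ> chart_inv c has_derivative L) (at (chart_map c p))" for L
    using has_derivative_transform_within_open[OF _ V] e by metis
  then show ?thesis by (simp add: partial_def frechet_derivative_def)
qed

text \<open>Real functions with a continuous gradient, an auxiliary notion for the proofs below.\<close>

definition C1_on :: "(real^3) set \<Rightarrow> (real^3 \<Rightarrow> real) \<Rightarrow> bool" where
  "C1_on S F \<longleftrightarrow>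
     (\<exists>D. continuous_on S D \<and> (\<forall>x\<in>S. (F has_derivative (\<lambda>h. D x \<bullet> h)) (at x)))"

lemma C1_onI:
  assumes "continuous_on S D" "\<And>x. x \<in> S \<Longrightarrow> (F has_derivative (\<lambda>h. D x \<bullet> h)) (at x)"
  shows "C1_on S F"
  using assms by (auto simp: C1_on_def)

lemma C1_on_imp_continuous_on: "C1_on S F \<Longrightarrow> continuous_on S F"
  unfolding C1_on_def
  by (auto intro!: continuous_at_imp_continuous_on intro: has_derivative_continuous)

lemma C1_on_cong:
  assumes "C1_on S F" "open S" "\<And>x. x \<in> S \<Longrightarrow> F x = G x"
  shows "C1_on S G"
proof -
  from assms(1) obtain D where D: "continuous_on S D"
    "\<And>x. x \<in> S \<Longrightarrow> (F has_derivative (\<lambda>h. D x \<bullet> h)) (at x)" unfolding C1_on_def by blast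
  show ?thesis
    by (rule C1_onI[OF D(1)], rule has_derivative_transform_within_open[OF D(2) assms(2)])
       (use assms(3) in auto)
qed

lemma C1_on_const: "C1_on S (\<lambda>x. a)"
  by (rule C1_onI[of S "\<lambda>x. 0"]) auto

lemma C1_on_add:
  assumes "C1_on S F" "C1_on S G" shows "C1_on S (\<lambda>x. F x + G x)"
proof -
  from assms obtain D E where
    "continuous_on S D" "continuous_on S E"
    "\<And>x. x \<in> S \<Longrightarrow> (F has_derivative (\<lambda>h. D x \<bullet> h)) (at x)"
    "\<And>x. x \<in> S \<Longrightarrow> (G has_derivative (\<lambda>h. E x \<bullet> h)) (at x)" unfolding C1_on_def by blast
  then show ?thesis
    by (intro C1_onI[of S "\<lambda>x. D x + E x"])
       (auto intro!: continuous_intros derivative_eq_intros simp: inner_add_left)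
qed

lemma C1_on_mult:
  assumes "C1_on S F" "C1_on S G" shows "C1_on S (\<lambda>x. F x * G x)"
proof -
  from assms obtain D E where
    "continuous_on S D" "continuous_on S E"
    "\<And>x. x \<in> S \<Longrightarrow> (F has_derivative (\<lambda>h. D x \<bullet> h)) (at x)"
    "\<And>x. x \<in> S \<Longrightarrow> (G has_derivative (\<lambda>h. E x \<bullet> h)) (at x)" unfolding C1_on_def by blast
  with C1_on_imp_continuous_on[OF assms(1)] C1_on_imp_continuous_on[OF assms(2)]
  show ?thesis
    by (intro C1_onI[of S "\<lambda>x. F x *\<^sub>R E x + G x *\<^sub>R D x"])
       (auto intro!: continuous_intros derivative_eq_intros simp: inner_add_left)
qed

lemma C1_on_diff:
  assumes "C1_on S F" "C1_on S G" shows "C1_on S (\<lambda>x. F x - G x)"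
  using C1_on_add[OF assms(1) C1_on_mult[OF C1_on_const[of S "-1"] assms(2)]] by simp

lemma C1_on_real_comp:
  assumes "C1_on S F" "\<And>x. x \<in> S \<Longrightarrow> (\<psi> has_real_derivative \<psi>' (F x)) (at (F x))"
    "continuous_on (F ` S) \<psi>'"
  shows "C1_on S (\<lambda>x. \<psi> (F x))"
proof -
  from assms(1) obtain D where D: "continuous_on S D"
    "\<And>x. x \<in> S \<Longrightarrow> (F has_derivative (\<lambda>h. D x \<bullet> h)) (at x)" unfolding C1_on_def by blast
  show ?thesis
  proof (rule C1_onI[of S "\<lambda>x. \<psi>' (F x) *\<^sub>R D x"])
    show "continuous_on S (\<lambda>x. \<psi>' (F x) *\<^sub>R D x)"
      using continuous_on_compose2[OF assms(3) C1_on_imp_continuous_on[OF assms(1)]] D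
      by (intro continuous_intros) auto
    show "((\<lambda>x. \<psi> (F x)) has_derivative (\<lambda>h. (\<psi>' (F x) *\<^sub>R D x) \<bullet> h)) (at x)" if "x \<in> S" for x
      using has_derivative_compose[OF D(2)[OF that] assms(2)[OF that, unfolded has_field_derivative_def]]
      by simp
  qed
qed

lemma C1_on_divide:
  assumes "C1_on S F" "C1_on S G" "\<And>x. x \<in> S \<Longrightarrow> G x \<noteq> 0"
  shows "C1_on S (\<lambda>x. F x / G x)"
proof -
  have "C1_on S (\<lambda>x. inverse (G x))"
    by (rule C1_on_real_comp[OF assms(2), where \<psi>' = "\<lambda>y. - (inverse y * inverse y)"])
       (use assms(3) in \<open>auto intro!: derivative_eq_intros continuous_intros\<close>)
  from C1_on_mult[OF assms(1) this] show ?thesis by (simp add: divide_inverse)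
qed

lemma C1_on_sqrt:
  assumes "C1_on S F" "\<And>x. x \<in> S \<Longrightarrow> F x > 0"
  shows "C1_on S (\<lambda>x. sqrt (F x))"
  by (rule C1_on_real_comp[OF assms(1), where \<psi>' = "\<lambda>y. inverse (sqrt y) / 2"])
     (use assms(2) in \<open>auto intro!: DERIV_real_sqrt continuous_intros simp: less_imp_neq[symmetric]\<close>)

lemma smooth_on_imp_C1_on:
  fixes F :: "real^3 \<Rightarrow> 'b::real_normed_vector"
  assumes "smooth_on S F" "bounded_linear L"
  shows "C1_on S (\<lambda>x. L (F x))"
proof -
  interpret bounded_linear L by fact
  have "Ck_on (Suc 0) S F" using assms(1) by (simp add: smooth_on_def del: Ck_on.simps)
  then have d: "\<And>x. x \<in> S \<Longrightarrow> F differentiable (at x)"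
    and k: "\<And>i. continuous_on S (\<lambda>x. frechet_derivative F (at x) (axis i 1))"
    by (auto simp: Basis_vec_def)
  show ?thesis
  proof (rule C1_onI[of S "\<lambda>x. \<chi> i. L (frechet_derivative F (at x) (axis i 1))"])
    show "continuous_on S (\<lambda>x. \<chi> i. L (frechet_derivative F (at x) (axis i 1)))"
      by (intro continuous_intros continuous_on k)
    show "((\<lambda>x. L (F x)) has_derivative
       (\<lambda>h. (\<chi> i. L (frechet_derivative F (at x) (axis i 1))) \<bullet> h)) (at x)" if x: "x \<in> S" for x
    proof -
      have D: "(F has_derivative frechet_derivative F (at x)) (at x)"
        using d[OF x] by (simp add: frechet_derivative_works)
      interpret F': bounded_linear "frechet_derivative F (at x)"
        using D by (rule has_derivative_bounded_linear)
      have "L (frechet_derivative F (at x) h)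
          = (\<chi> i. L (frechet_derivative F (at x) (axis i 1))) \<bullet> h" for h
      proof -
        have "h = (\<Sum>i\<in>UNIV. h $ i *\<^sub>R axis i 1)"
          by (simp add: basis_expansion scalar_mult_eq_scaleR[symmetric])
        then have "L (frechet_derivative F (at x) h)
            = L (frechet_derivative F (at x) (\<Sum>i\<in>UNIV. h $ i *\<^sub>R axis i 1))" by simp
        also have "\<dots> = (\<Sum>i\<in>UNIV. h $ i * L (frechet_derivative F (at x) (axis i 1)))"
          by (simp add: F'.sum F'.scaleR sum scaleR)
        finally show ?thesis by (simp add: inner_vec_def mult.commute)
      qed
      then have "(\<lambda>h. L (frechet_derivative F (at x) h))
          = (\<lambda>h. (\<chi> i. L (frechet_derivative F (at x) (axis i 1))) \<bullet> h)" by (rule ext)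
      then show ?thesis
        using has_derivative_compose[OF D bounded_linear_imp_has_derivative[OF assms(2)]] by metis
    qed
  qed
qed

lemma integral_compact_support_integrable:
  fixes F :: "real^3 \<Rightarrow> real"
  assumes "continuous_on V F" "compact K" "K \<subseteq> V" "\<And>x. x \<in> V - K \<Longrightarrow> F x = 0"
  shows "set_integrable lborel V F"
proof -
  have "integrable lborel (\<lambda>x. indicator K x *\<^sub>R F x)"
    using assms by (intro borel_integrable_compact continuous_on_subset[OF assms(1)]) auto
  moreover have "(\<lambda>x. indicat_real K x *\<^sub>R F x) = (\<lambda>x. indicat_real V x *\<^sub>R F x)"
    using assms by (force simp: indicator_def fun_eq_iff)
  ultimately show ?thesis by (simp add: set_integrable_def)
qed

lemma set_integral_derivative_compact_support:
  fixes F :: "real^3 \<Rightarrow> real"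
  assumes V: "open V" and cont: "continuous_on V D"
    and der: "\<And>x. x \<in> V \<Longrightarrow> (F has_derivative (\<lambda>h. D x \<bullet> h)) (at x)"
    and K: "compact K" "K \<subseteq> V" and supp: "\<And>x. x \<in> V - K \<Longrightarrow> F x = 0"
  shows "(LINT x:V|lborel. D x \<bullet> b) = 0" and "\<And>x. x \<in> V - K \<Longrightarrow> D x = 0"
proof -
  have oK: "open (- K)" using K compact_imp_closed by blast
  show D0: "D x = 0" if x: "x \<in> V - K" for x
  proof -
    have "(F has_derivative (\<lambda>h. 0)) (at x)"
      by (rule has_derivative_transform_within_open[of "\<lambda>_. 0" _ _ _ "V - K"])
         (use V oK supp x in \<open>auto simp: open_Diff K compact_imp_closed\<close>)
    then have "(\<lambda>h. D x \<bullet> h) = (\<lambda>h. 0)" using der x has_derivative_unique by blast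
    then show ?thesis by (metis inner_eq_zero_iff)
  qed
  define F1 where "F1 x = (if x \<in> V then F x else 0)" for x
  define D1 where "D1 x = (if x \<in> V then D x else 0)" for x
  have "(LINT x|lborel. D1 x \<bullet> b) = 0"
  proof (rule integral_derivative_compact_support[of F1 D1 K])
    show "(F1 has_derivative (\<lambda>h. D1 x \<bullet> h)) (at x)" for x
    proof (cases "x \<in> V")
      case True
      show ?thesis
        by (rule has_derivative_transform_within_open[of F _ _ _ V])
           (use True V der in \<open>auto simp: F1_def D1_def\<close>)
    next
      case False
      show ?thesis
        by (rule has_derivative_transform_within_open[of "\<lambda>_. 0" _ _ _ "- K"])
           (use False oK K supp in \<open>auto simp: F1_def D1_def\<close>)
    qed
    have "continuous_on (V \<union> - K) D1"
    proof (rule continuous_on_open_Un[OF V oK])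
      show "continuous_on V D1" using cont by (simp add: D1_def cong: continuous_on_cong)
      have "continuous_on (- K) (\<lambda>_. 0 :: real^3)" by simp
      then show "continuous_on (- K) D1"
        by (rule continuous_on_eq) (use D0 in \<open>auto simp: D1_def\<close>)
    qed
    moreover have "V \<union> - K = UNIV" using K by auto
    ultimately show "continuous_on UNIV D1" by simp
  qed (use K supp in \<open>auto simp: F1_def\<close>)
  also have "(LINT x|lborel. D1 x \<bullet> b) = (LINT x:V|lborel. D x \<bullet> b)"
    unfolding set_lebesgue_integral_def D1_def by (intro Bochner_Integration.integral_cong) auto
  finally show "(LINT x:V|lborel. D x \<bullet> b) = 0" .
qed

lemma metric_facts:
  assumes "riemannian_metric A g" "c \<in> A" "p \<in> chart_dom c"
  shows "det (g c p) > 0" and "g c p $ i $ j = g c p $ j $ i"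
    and "g c p ** matrix_inv (g c p) = mat 1" and "matrix_inv (g c p) ** g c p = mat 1"
    and "transpose (g c p) = g c p"
proof -
  have "transpose (g c p) = g c p \<and> (\<forall>v. v \<noteq> 0 \<longrightarrow> v \<bullet> (g c p *v v) > 0)"
    using assms unfolding riemannian_metric_def by blast
  then have sym: "transpose (g c p) = g c p"
    and pos: "\<And>v. v \<noteq> 0 \<Longrightarrow> v \<bullet> (g c p *v v) > 0" by blast+
  show d: "det (g c p) > 0" using pos by (rule det_pos_if_posdef)
  show "transpose (g c p) = g c p" by (fact sym)
  have "g c p $ i $ j = transpose (g c p) $ i $ j" by (simp only: sym)
  then show "g c p $ i $ j = g c p $ j $ i" by (simp add: transpose_def)
  have "invertible (g c p)" using d by (simp add: invertible_det_nz)
  then show "g c p ** matrix_inv (g c p) = mat 1" "matrix_inv (g c p) ** g c p = mat 1"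
    unfolding invertible_def matrix_inv_def by (metis (mono_tags, lifting) someI_ex)+
qed

lemma endo_of_characterization:
  assumes "riemannian_metric A g" "c \<in> A" "p \<in> chart_dom c"
  shows "(endo_of g h c p *v v) \<bullet> (g c p *v w) = v \<bullet> (h c p *v w)"
    and "v \<bullet> (form_of_endo g E c p *v w) = (E c p *v v) \<bullet> (g c p *v w)"
    and "form_of_endo g (endo_of g h) c p = h c p"
proof -
  note m = metric_facts[OF assms]
  have t: "transpose (matrix_inv (g c p)) ** g c p = mat 1"
  proof -
    have "transpose (matrix_inv (g c p)) ** g c p = transpose (g c p ** matrix_inv (g c p))"
      by (simp add: matrix_transpose_mul m(5))
    then show ?thesis using m(3) by (simp add: transpose_mat)
  qed
  show *: "v \<bullet> (form_of_endo g E c p *v w) = (E c p *v v) \<bullet> (g c p *v w)" for v w E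
    using dot_lmul_matrix[of v "transpose (E c p)" "g c p *v w"]
    by (simp add: form_of_endo_def matrix_vector_mul_assoc[symmetric])
  show f: "form_of_endo g (endo_of g h) c p = h c p"
    by (simp add: form_of_endo_def endo_of_def matrix_transpose_mul matrix_mul_assoc[symmetric] t)
  show "(endo_of g h c p *v v) \<bullet> (g c p *v w) = v \<bullet> (h c p *v w)"
    using *[of v "endo_of g h" w] f by simp
qed

lemma christoffel_torsion_free:
  assumes "oriented_atlas M A" "riemannian_metric A g" "c \<in> A" "p \<in> chart_dom c"
  shows "christoffel g c p k i j = christoffel g c p k j i"
proof -
  have "is_chart M c" using assms by (simp add: oriented_atlas_def)
  then have "partial c l (\<lambda>q. g c q $ i $ j) p = partial c l (\<lambda>q. g c q $ j $ i) p" for l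
    by (rule partial_cong[OF _ assms(4)]) (rule metric_facts(2)[OF assms(2,3)])
  then show ?thesis by (simp add: christoffel_def algebra_simps)
qed

lemma christoffel_metric_compatible:
  assumes "oriented_atlas M A" "riemannian_metric A g" "c \<in> A" "p \<in> chart_dom c"
  shows "partial c k (\<lambda>q. g c q $ i $ j) p =
    (\<Sum>l\<in>UNIV. christoffel g c p l k i * g c p $ l $ j)
    + (\<Sum>l\<in>UNIV. christoffel g c p l k j * g c p $ i $ l)"
proof -
  have c: "is_chart M c" using assms by (simp add: oriented_atlas_def)
  have sym: "partial c l (\<lambda>q. g c q $ i $ j) p = partial c l (\<lambda>q. g c q $ j $ i) p" for l i j
    by (rule partial_cong[OF c assms(4)]) (rule metric_facts(2)[OF assms(2,3)])
  define T where "T i j l = (partial c i (\<lambda>q. g c q $ j $ l) p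
     + partial c j (\<lambda>q. g c q $ i $ l) p - partial c l (\<lambda>q. g c q $ i $ j) p)" for i j l
  have low: "(\<Sum>l\<in>UNIV. christoffel g c p l i j * g c p $ n $ l) = T i j n / 2" for i j n
  proof -
    have "(\<Sum>l\<in>UNIV. christoffel g c p l i j * g c p $ n $ l)
      = (\<Sum>l\<in>UNIV. \<Sum>m\<in>UNIV. matrix_inv (g c p) $ l $ m * T i j m / 2 * g c p $ n $ l)"
      by (simp add: christoffel_def T_def sum_distrib_right sum_divide_distrib)
    also have "\<dots> = (\<Sum>m\<in>UNIV. \<Sum>l\<in>UNIV. matrix_inv (g c p) $ l $ m * T i j m / 2 * g c p $ n $ l)"
      by (rule sum.swap)
    also have "\<dots> = (\<Sum>m\<in>UNIV. (g c p ** matrix_inv (g c p)) $ n $ m * (T i j m / 2))"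
      by (simp add: matrix_matrix_mult_def sum_3 algebra_simps add_divide_distrib)
    also have "\<dots> = T i j n / 2"
      unfolding metric_facts(3)[OF assms(2-4)]
      using exhaust_3[of n] by (auto simp: mat_def sum_3)
    finally show ?thesis .
  qed
  have "(\<Sum>l\<in>UNIV. christoffel g c p l k i * g c p $ l $ j)
      = (\<Sum>l\<in>UNIV. christoffel g c p l k i * g c p $ j $ l)"
    by (rule sum.cong) (use metric_facts(2)[OF assms(2-4), of _ j] in auto)
  then show ?thesis
    unfolding low T_def using sym[of k j i] by (simp add: low T_def field_simps)
qed

text \<open>The integral over the domain of a chart against the Riemannian volume.\<close>

definition chart_integral ::
    "'a bilinear_field \<Rightarrow> 'a chart \<Rightarrow> ('a \<Rightarrow> real) \<Rightarrow> real" where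
  "chart_integral g c F =
     (LINT x:chart_map c ` chart_dom c|lborel. F (chart_inv c x) * sqrt (det (g c (chart_inv c x))))"

text \<open>The identity \<open>\<langle>du, \<phi>\<rangle> = \<langle>u, \<delta>\<phi>\<rangle>\<close> in \<open>L\<^sup>2\<close> for test functions \<open>u\<close> supported in a chart; it determines
  the continuous function \<open>\<delta>\<phi>\<close>.\<close>

lemma codifferential_formal_adjoint:
  assumes atlas: "oriented_atlas M A" and g: "riemannian_metric A g" and \<phi>: "one_form A \<phi>"
    and u: "smooth_function A u" and c: "c \<in> A"
    and K: "compactin M K" "K \<subseteq> chart_dom c" and supp: "\<And>p. p \<in> chart_dom c - K \<Longrightarrow> u p = 0"
  shows "chart_integral g c (\<lambda>p. form_inner g (differential u) \<phi> c p) =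
         chart_integral g c (\<lambda>p. u p * codifferential g \<phi> c p)"
proof -
  define V where "V = chart_map c ` chart_dom c"
  define K' where "K' = chart_map c ` K"
  define X where "X i x = sqrt (det (g c (chart_inv c x))) * sharp g \<phi> c (chart_inv c x) $ i" for i x
  define U where "U x = u (chart_inv c x)" for x
  have ch: "is_chart M c" using atlas c by (simp add: oriented_atlas_def)
  then have V: "open V" by (simp add: is_chart_def V_def)
  note ci = chart_bij[OF ch, folded V_def]
  note m = metric_facts[OF g c ci(5)]
  have K'V: "K' \<subseteq> V" using K by (auto simp: K'_def V_def)
  have K'c: "compact K'"
  proof -
    have "compactin (subtopology M (chart_dom c)) K" using K by (simp add: compactin_subtopology)
    moreover have "continuous_map (subtopology M (chart_dom c)) (top_of_set V) (chart_map c)"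
      using ch homeomorphic_imp_continuous_map by (auto simp: is_chart_def V_def)
    ultimately have "compactin (top_of_set V) K'" unfolding K'_def by (rule image_compactin)
    then show ?thesis by (simp add: compactin_subtopology)
  qed
  have U0: "U x = 0" if "x \<in> V - K'" for x
    using that supp ci(4,5)[of x] unfolding U_def K'_def by (metis DiffD1 DiffD2 DiffI imageI)
  have "smooth_on V (\<lambda>x. g c (chart_inv c x))" "smooth_on V (\<lambda>x. \<phi> c (chart_inv c x))" "smooth_on V U"
    using g \<phi> u c unfolding riemannian_metric_def one_form_def smooth_function_def
        smooth_in_chart_def comp_def V_def U_def[abs_def] by blast+
  note s = this[THEN smooth_on_imp_C1_on]
  have Cg: "C1_on V (\<lambda>x. g c (chart_inv c x) $ i $ j)" for i j
    by (rule s(1)) (intro bounded_linear_compose[OF bounded_linear_vec_nth bounded_linear_vec_nth])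
  have C\<phi>: "C1_on V (\<lambda>x. \<phi> c (chart_inv c x) $ i)" for i
    by (rule s(2)) (rule bounded_linear_vec_nth)
  have CU: "C1_on V U" using s(3)[OF bounded_linear_ident] by simp
  note C1 = C1_on_add C1_on_diff C1_on_mult Cg C\<phi>
  have CX: "C1_on V (X i)" for i
  proof -
    have det: "C1_on V (\<lambda>x. det (g c (chart_inv c x)))"
      unfolding det_3 by (intro C1)
    have rep: "C1_on V (\<lambda>x. det (\<chi> r k. if k = i then \<phi> c (chart_inv c x) $ r
                                   else g c (chart_inv c x) $ r $ k))"
      using exhaust_3[of i] unfolding det_3 by (auto intro!: C1)
    have "C1_on V (\<lambda>x. sqrt (det (g c (chart_inv c x))) *
        (det (\<chi> r k. if k = i then \<phi> c (chart_inv c x) $ r else g c (chart_inv c x) $ r $ k)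
         / det (g c (chart_inv c x))))"
      by (intro C1_on_mult C1_on_sqrt C1_on_divide det rep) (use m(1) in \<open>force+\<close>)
    then show ?thesis
    proof (rule C1_on_cong[OF _ V])
      fix x assume x: "x \<in> V"
      let ?p = "chart_inv c x"
      have "g c ?p *v sharp g \<phi> c ?p = \<phi> c ?p"
        by (simp add: sharp_def matrix_vector_mul_assoc m(3)[OF x])
      then have "sharp g \<phi> c ?p $ i =
          det (\<chi> r k. if k = i then \<phi> c ?p $ r else g c ?p $ r $ k) / det (g c ?p)"
        using cramer[of "g c ?p" "sharp g \<phi> c ?p" "\<phi> c ?p"] m(1)[OF x] by (simp add: vec_eq_iff)
      then show "sqrt (det (g c ?p)) *
          (det (\<chi> r k. if k = i then \<phi> c ?p $ r else g c ?p $ r $ k) / det (g c ?p)) = X i x"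
        by (simp add: X_def)
    qed
  qed
  then obtain DX where DX: "\<And>i. continuous_on V (DX i)"
      "\<And>i x. x \<in> V \<Longrightarrow> (X i has_derivative (\<lambda>h. DX i x \<bullet> h)) (at x)"
    unfolding C1_on_def by metis
  from CU obtain DU where DU: "continuous_on V DU"
      "\<And>x. x \<in> V \<Longrightarrow> (U has_derivative (\<lambda>h. DU x \<bullet> h)) (at x)"
    unfolding C1_on_def by metis
  have contX: "continuous_on V (X i)" for i using CX C1_on_imp_continuous_on by blast
  have contU: "continuous_on V U" using CU C1_on_imp_continuous_on by blast
  define H where "H i x = U x * X i x" for i x
  define DH where "DH i x = U x *\<^sub>R DX i x + X i x *\<^sub>R DU x" for i x
  have derH: "(H i has_derivative (\<lambda>h. DH i x \<bullet> h)) (at x)" if "x \<in> V" for i x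
    unfolding H_def DH_def using DX(2)[OF that, of i] DU(2)[OF that]
    by (auto intro!: derivative_eq_intros simp: inner_add_left)
  have contH: "continuous_on V (DH i)" for i
    unfolding DH_def by (intro continuous_intros contX contU DX DU)
  have zero: "(LINT x:V|lborel. DH i x \<bullet> axis i 1) = 0" for i
    by (rule set_integral_derivative_compact_support(1)[OF V contH derH K'c K'V])
       (auto simp: H_def U0)
  have DU0: "DU x = 0" if "x \<in> V - K'" for x
    by (rule set_integral_derivative_compact_support(2)[OF V DU(1) DU(2) K'c K'V U0 that])
  have intH: "set_integrable lborel V (\<lambda>x. DH i x \<bullet> axis i 1)" for i
    by (rule integral_compact_support_integrable[OF _ K'c K'V])
       (auto simp: DH_def U0 DU0 intro!: continuous_intros contX contU DX DU)
  define P where "P x = (\<Sum>i\<in>UNIV. DU x $ i * X i x)" for x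
  define Q where "Q x = - U x * (\<Sum>i\<in>UNIV. DX i x $ i)" for x
  have intP: "set_integrable lborel V P" and intQ: "set_integrable lborel V Q"
    unfolding P_def Q_def
    by (rule integral_compact_support_integrable[OF _ K'c K'V];
        force simp: U0 DU0 intro!: continuous_intros contX contU DX DU)+
  have lhs: "form_inner g (differential u) \<phi> c (chart_inv c x) * sqrt (det (g c (chart_inv c x))) = P x"
    if x: "x \<in> V" for x
  proof -
    have "partial c i u (chart_inv c x) = DU x \<bullet> axis i 1" for i
      by (rule partial_eqI) (use DU(2)[OF x] ci(4)[OF x] in \<open>simp add: U_def[abs_def]\<close>)
    then have "partial c i u (chart_inv c x) = DU x $ i" for i by (simp add: inner_axis)
    then show ?thesis
      by (simp add: form_inner_def differential_def P_def X_def inner_vec_def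
          sum_3 algebra_simps)
  qed
  have rhs: "u (chart_inv c x) * codifferential g \<phi> c (chart_inv c x)
      * sqrt (det (g c (chart_inv c x))) = Q x" if x: "x \<in> V" for x
  proof -
    have h: "hodge1 g \<phi> c q $ 2 $ 3 = sqrt (det (g c q)) * sharp g \<phi> c q $ 1"
        "hodge1 g \<phi> c q $ 3 $ 1 = sqrt (det (g c q)) * sharp g \<phi> c q $ 2"
        "hodge1 g \<phi> c q $ 1 $ 2 = sqrt (det (g c q)) * sharp g \<phi> c q $ 3" for q
      by (simp_all add: hodge1_def det_3 axis_def)
    have "partial c i (\<lambda>q. sqrt (det (g c q)) * sharp g \<phi> c q $ i) (chart_inv c x) = DX i x \<bullet> axis i 1" for i
      by (rule partial_eqI) (use DX(2)[OF x, of i] ci(4)[OF x] in \<open>simp add: X_def[abs_def]\<close>)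
    then have "ext_deriv2 (hodge1 g \<phi>) c (chart_inv c x) = (\<Sum>i\<in>UNIV. DX i x $ i)"
      by (simp add: ext_deriv2_def h sum_3 inner_axis)
    then show ?thesis
      using m(1)[OF x] by (simp add: codifferential_def hodge3_def Q_def U_def)
  qed
  have "(LINT x:V|lborel. P x) - (LINT x:V|lborel. Q x) = (LINT x:V|lborel. P x - Q x)"
    by (rule set_integral_diff(2)[OF intP intQ, symmetric])
  also have "\<dots> = (LINT x:V|lborel. (\<Sum>i\<in>UNIV. DH i x \<bullet> axis i 1))"
    by (simp add: P_def Q_def DH_def inner_add_left inner_axis sum_3 algebra_simps)
  also have "\<dots> = (\<Sum>i\<in>UNIV. LINT x:V|lborel. DH i x \<bullet> axis i 1)"
    using intH by (simp add: sum_3 set_integral_add)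
  finally have "(LINT x:V|lborel. P x) = (LINT x:V|lborel. Q x)" by (simp add: zero)
  moreover have "chart_integral g c (\<lambda>p. form_inner g (differential u) \<phi> c p) = (LINT x:V|lborel. P x)"
    unfolding chart_integral_def V_def[symmetric]
    by (rule set_lebesgue_integral_cong) (use V lhs in auto)
  moreover have "chart_integral g c (\<lambda>p. u p * codifferential g \<phi> c p) = (LINT x:V|lborel. Q x)"
    unfolding chart_integral_def V_def[symmetric]
    by (rule set_lebesgue_integral_cong) (use V rhs in auto)
  ultimately show ?thesis by simp
qed

end

theory Submission
  imports Defs "HOL-Computational_Algebra.Polynomial"
begin

text \<open>The dilaton of an Einstein soliton is constant because it satisfies an overdetermined system.

  Write \<open>y = f\<^sup>2\<close> and \<open>w = |\<phi>|\<^sup>2\<close>.  For \<open>Ric = \<Lambda> g\<close> the commutator vanishes and, with \<open>df = f \<phi>\<close>, the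
  first soliton equation becomes
  \<open>\<nabla>\<phi> = - (\<Phi>(y) + \<kappa>yw / 4) g - (\<kappa>y / 4) \<phi> \<otimes> \<phi>\<close>
  with \<open>\<Phi>(y) = \<Lambda> - y / 2 + \<kappa> (y - 2\<Lambda>)\<^sup>2 / 8\<close> (\<open>einstein_soliton_reduction\<close>).  This determines \<open>dw\<close>, which is
  \<open>2 (\<nabla>\<phi>)(-, \<phi>\<^sup>\<sharp>) = - (2\<Phi>(y) + \<kappa>yw) \<phi>\<close>.  On the other hand \<open>\<delta>\<phi>\<close> is minus the trace of \<open>\<nabla>\<phi>\<close>
  (\<open>codifferential_eq_neg_trace\<close>), and the scalar soliton equation prescribes \<open>\<delta>\<phi>\<close> too; eliminating it gives
  the algebraic relation \<open>(2 + 3\<kappa>y) w = 3\<Lambda> + y / 2 - 9\<Phi>(y)\<close> (\<open>einstein_soliton_norm\<close>).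

  Differentiating this relation and inserting the formula for \<open>dw\<close> and \<open>dy = 2y \<phi>\<close> produces a polynomial
  \<open>P\<close> of degree four with \<open>P(y) \<phi> = 0\<close> (\<open>dilaton_polynomial_annihilates_form\<close>), so \<open>P(f\<^sup>2) df = 0\<close>.
  A function whose differential is annihilated by a nonconstant polynomial in it takes, locally, values in a
  finite set, and is therefore constant on a connected manifold
  (\<open>constant_if_polynomial_annihilates_differential\<close>).\<close>

section \<open>Partial derivatives of functions on a chart\<close>
definition differentiable_in_chart :: "'a chart \<Rightarrow> 'a \<Rightarrow> ('a \<Rightarrow> real) \<Rightarrow> bool" where
  "differentiable_in_chart c p F \<longleftrightarrow> (\<lambda>x. F (chart_inv c x)) differentiable (at (chart_map c p))"

lemma differentiable_in_chart_has_derivative: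
  assumes "differentiable_in_chart c p F"
  obtains L where "((\<lambda>x. F (chart_inv c x)) has_derivative L) (at (chart_map c p))"
    "\<And>i. partial c i F p = L (axis i 1)"
  using assms unfolding differentiable_in_chart_def differentiable_def
  by (metis partial_eqI)

lemma smooth_in_chart_component_C1_on:
  assumes "smooth_in_chart c F" "bounded_linear L"
  shows "C1_on (chart_map c ` chart_dom c) (\<lambda>x. L (F (chart_inv c x)))"
  using smooth_on_imp_C1_on[OF _ assms(2)] assms(1) unfolding smooth_in_chart_def comp_def by blast

lemma C1_on_imp_differentiable_in_chart:
  assumes "C1_on (chart_map c ` chart_dom c) (\<lambda>x. F (chart_inv c x))" "p \<in> chart_dom c"
  shows "differentiable_in_chart c p F"
  using assms unfolding C1_on_def differentiable_in_chart_def differentiable_def by blast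

text \<open>The coordinate map is inverted by \<open>chart_inv\<close> only on the domain of the chart, so evaluating a
  coordinate expression at \<open>p\<close> itself, as in the product and chain rules, needs \<open>p\<close> in the domain.\<close>
context
  fixes M :: "'a topology" and c :: "'a chart" and p :: 'a
  assumes chart: "is_chart M c" and p: "p \<in> chart_dom c"
begin

lemma partial_add:
  assumes "differentiable_in_chart c p F" "differentiable_in_chart c p G"
  shows "differentiable_in_chart c p (\<lambda>q. F q + G q)"
    and "partial c i (\<lambda>q. F q + G q) p = partial c i F p + partial c i G p"
proof -
  obtain K L where K: "((\<lambda>x. F (chart_inv c x)) has_derivative K) (at (chart_map c p))"
      "\<And>i. partial c i F p = K (axis i 1)"
    and L: "((\<lambda>x. G (chart_inv c x)) has_derivative L) (at (chart_map c p))"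
      "\<And>i. partial c i G p = L (axis i 1)"
    using assms by (metis differentiable_in_chart_has_derivative)
  note d = has_derivative_add[OF K(1) L(1)]
  show "differentiable_in_chart c p (\<lambda>q. F q + G q)"
    using d unfolding differentiable_in_chart_def differentiable_def by blast
  show "partial c i (\<lambda>q. F q + G q) p = partial c i F p + partial c i G p"
    using partial_eqI[OF d] by (simp add: K(2) L(2))
qed

lemma partial_mult:
  assumes "differentiable_in_chart c p F" "differentiable_in_chart c p G"
  shows "differentiable_in_chart c p (\<lambda>q. F q * G q)"
    and "partial c i (\<lambda>q. F q * G q) p = F p * partial c i G p + partial c i F p * G p"
proof -
  obtain K L where K: "((\<lambda>x. F (chart_inv c x)) has_derivative K) (at (chart_map c p))"
      "\<And>i. partial c i F p = K (axis i 1)"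
    and L: "((\<lambda>x. G (chart_inv c x)) has_derivative L) (at (chart_map c p))"
      "\<And>i. partial c i G p = L (axis i 1)"
    using assms by (metis differentiable_in_chart_has_derivative)
  note d = has_derivative_mult[OF K(1) L(1)]
  show "differentiable_in_chart c p (\<lambda>q. F q * G q)"
    using d unfolding differentiable_in_chart_def differentiable_def by blast
  show "partial c i (\<lambda>q. F q * G q) p = F p * partial c i G p + partial c i F p * G p"
    using partial_eqI[OF d] by (simp add: K(2) L(2) chart_bij(3)[OF chart p])
qed

lemma partial_chain:
  assumes "differentiable_in_chart c p F" "(\<psi> has_real_derivative m) (at (F p))"
  shows "differentiable_in_chart c p (\<lambda>q. \<psi> (F q))"
    and "partial c i (\<lambda>q. \<psi> (F q)) p = m * partial c i F p"
proof -
  obtain K where K: "((\<lambda>x. F (chart_inv c x)) has_derivative K) (at (chart_map c p))"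
      "\<And>i. partial c i F p = K (axis i 1)"
    using assms by (metis differentiable_in_chart_has_derivative)
  have d: "((\<lambda>x. \<psi> (F (chart_inv c x))) has_derivative (\<lambda>h. m * K h)) (at (chart_map c p))"
    by (rule has_derivative_compose[OF K(1)])
       (use assms(2) in \<open>simp add: chart_bij(3)[OF chart p] has_field_derivative_def\<close>)
  show "differentiable_in_chart c p (\<lambda>q. \<psi> (F q))"
    using d unfolding differentiable_in_chart_def differentiable_def by blast
  show "partial c i (\<lambda>q. \<psi> (F q)) p = m * partial c i F p"
    using partial_eqI[OF d] by (simp add: K(2))
qed

lemma partial_const:
  shows "differentiable_in_chart c p (\<lambda>q. a)" and "partial c i (\<lambda>q. a) p = 0"
  using partial_eqI[of "\<lambda>q. a" c "\<lambda>_. 0" p] by (simp_all add: differentiable_in_chart_def)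

lemma partial_sum3:
  assumes "\<And>l::3. differentiable_in_chart c p (F l)"
  shows "differentiable_in_chart c p (\<lambda>q. \<Sum>l\<in>UNIV. F l q)"
    and "partial c i (\<lambda>q. \<Sum>l\<in>UNIV. F l q) p = (\<Sum>l\<in>UNIV. partial c i (F l) p)"
  using assms by (simp_all add: sum_3 partial_add)

lemma differentiable_in_chart_cong:
  assumes "differentiable_in_chart c p F" "\<And>q. q \<in> chart_dom c \<Longrightarrow> F q = G q"
  shows "differentiable_in_chart c p G"
proof -
  let ?V = "chart_map c ` chart_dom c"
  obtain K where K: "((\<lambda>x. F (chart_inv c x)) has_derivative K) (at (chart_map c p))"
    using assms(1) by (metis differentiable_in_chart_has_derivative)
  have "((\<lambda>x. G (chart_inv c x)) has_derivative K) (at (chart_map c p))"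
    by (rule has_derivative_transform_within_open[OF K, of ?V])
       (use chart p assms(2) chart_bij(5)[OF chart] in \<open>auto simp: is_chart_def\<close>)
  then show ?thesis unfolding differentiable_in_chart_def differentiable_def by blast
qed

end

section \<open>The covariant derivative in terms of the dual vector field\<close>

text \<open>Jacobi's formula for \<open>3 \<times> 3\<close> matrices.  The left-hand side is the derivative of \<open>det\<close> at \<open>G\<close> in the
  direction \<open>E\<close>; with \<open>E = G ** B\<close> the formula is a polynomial identity in the entries of
  \<open>G\<close> and \<open>B\<close>, free of inverses.\<close>
lemma det_derivative_times_matrix:
  fixes G B :: "real^3^3"
  assumes "E = G ** B"
  shows "E$1$1 * (G$2$2 * G$3$3 - G$2$3 * G$3$2) + E$1$2 * (G$2$3 * G$3$1 - G$2$1 * G$3$3)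
       + E$1$3 * (G$2$1 * G$3$2 - G$2$2 * G$3$1)
       + E$2$1 * (G$3$2 * G$1$3 - G$3$3 * G$1$2) + E$2$2 * (G$3$3 * G$1$1 - G$3$1 * G$1$3)
       + E$2$3 * (G$3$1 * G$1$2 - G$3$2 * G$1$1)
       + E$3$1 * (G$1$2 * G$2$3 - G$1$3 * G$2$2) + E$3$2 * (G$1$3 * G$2$1 - G$1$1 * G$2$3)
       + E$3$3 * (G$1$1 * G$2$2 - G$1$2 * G$2$1)
     = det G * trace B"
  unfolding assms by (simp add: det_3 trace_def matrix_matrix_mult_def sum_3) algebra

lemma partial_det:
  fixes g :: "'a bilinear_field" and H :: "real^3^3"
  assumes chart: "is_chart M c" "p \<in> chart_dom c"
    and d: "\<And>i j. differentiable_in_chart c p (\<lambda>q. g c q $ i $ j)"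
    and inv: "g c p ** H = mat 1"
  shows "differentiable_in_chart c p (\<lambda>q. det (g c q))"
    and "partial c l (\<lambda>q. det (g c q)) p
      = det (g c p) * (\<Sum>i\<in>UNIV. \<Sum>j\<in>UNIV. H $ i $ j * partial c l (\<lambda>q. g c q $ j $ i) p)"
proof -
  note pm = partial_mult[OF chart] and pa = partial_add[OF chart] and pc = partial_const[OF chart]
  define C where "C q = g c q$1$1 * (g c q$2$2 * g c q$3$3 + (-1) * (g c q$2$3 * g c q$3$2))
     + (g c q$1$2 * (g c q$2$3 * g c q$3$1 + (-1) * (g c q$2$1 * g c q$3$3))
     + g c q$1$3 * (g c q$2$1 * g c q$3$2 + (-1) * (g c q$2$2 * g c q$3$1)))" for q
  have C: "(\<lambda>q. det (g c q)) = C" by (simp add: fun_eq_iff C_def det_3 algebra_simps)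
  show "differentiable_in_chart c p (\<lambda>q. det (g c q))"
    unfolding C C_def[abs_def] by (intro pm(1) pa(1) pc(1) d)
  define E where "E = (\<chi> i j. partial c l (\<lambda>q. g c q $ i $ j) p)"
  have E: "partial c l (\<lambda>q. g c q $ i $ j) p = E $ i $ j" for i j by (simp add: E_def)
  have "E = g c p ** (H ** E)" by (simp add: matrix_mul_assoc inv)
  note J = det_derivative_times_matrix[OF this]
  have "partial c l (\<lambda>q. det (g c q)) p = det (g c p) * trace (H ** E)"
    unfolding C C_def[abs_def] J[symmetric]
    by (simp only: pm pa pc d E) (simp add: algebra_simps)
  then show "partial c l (\<lambda>q. det (g c q)) p
      = det (g c p) * (\<Sum>i\<in>UNIV. \<Sum>j\<in>UNIV. H $ i $ j * partial c l (\<lambda>q. g c q $ j $ i) p)"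
    by (simp add: trace_def matrix_matrix_mult_def E)
qed


lemma inverse_metric_symmetric:
  assumes "riemannian_metric A g" "c \<in> A" "p \<in> chart_dom c"
  shows "matrix_inv (g c p) $ i $ j = matrix_inv (g c p) $ j $ i"
proof -
  note m = metric_facts[OF assms]
  let ?H = "matrix_inv (g c p)"
  have "transpose ?H ** g c p = transpose (g c p ** ?H)" by (simp add: matrix_transpose_mul m(5))
  then have "transpose ?H ** g c p = mat 1" by (simp add: m(3) transpose_mat)
  then have "transpose ?H ** g c p ** ?H = ?H" by simp
  then have "transpose ?H = ?H" by (simp add: matrix_mul_assoc[symmetric] m(3))
  then have "?H $ i $ j = transpose ?H $ i $ j" by simp
  then show ?thesis by (simp add: transpose_def)
qed

lemma metric_times_sharp:
  assumes "riemannian_metric A g" "c \<in> A" "p \<in> chart_dom c"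
  shows "\<phi> c p $ j = (\<Sum>l\<in>UNIV. g c p $ j $ l * sharp g \<phi> c p $ l)"
proof -
  have "g c p *v sharp g \<phi> c p = \<phi> c p"
    by (simp add: sharp_def matrix_vector_mul_assoc metric_facts[OF assms])
  then show ?thesis by (simp add: matrix_vector_mult_def vec_eq_iff)
qed

lemma metric_trace_sum:
  "metric_trace g h c p = (\<Sum>i\<in>UNIV. \<Sum>j\<in>UNIV. matrix_inv (g c p) $ i $ j * h c p $ i $ j)"
  by (simp add: metric_trace_def endo_of_def trace_def matrix_matrix_mult_def transpose_def)

lemma tensor_components_differentiable:
  assumes "is_chart M c" "riemannian_metric A g" "one_form A \<phi>" "c \<in> A" "p \<in> chart_dom c"
  shows "differentiable_in_chart c p (\<lambda>q. g c q $ i $ j)"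
    and "differentiable_in_chart c p (\<lambda>q. \<phi> c q $ i)"
    and "differentiable_in_chart c p (\<lambda>q. sharp g \<phi> c q $ i)"
proof -
  let ?V = "chart_map c ` chart_dom c"
  have sm: "smooth_in_chart c (g c)" "smooth_in_chart c (\<phi> c)"
    using assms unfolding riemannian_metric_def one_form_def by blast+
  have Cg: "C1_on ?V (\<lambda>x. g c (chart_inv c x) $ i $ j)" for i j
    by (rule smooth_in_chart_component_C1_on[OF sm(1)])
       (intro bounded_linear_compose[OF bounded_linear_vec_nth bounded_linear_vec_nth])
  have C\<phi>: "C1_on ?V (\<lambda>x. \<phi> c (chart_inv c x) $ i)" for i
    by (rule smooth_in_chart_component_C1_on[OF sm(2)]) (rule bounded_linear_vec_nth)
  show "differentiable_in_chart c p (\<lambda>q. g c q $ i $ j)"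
    by (rule C1_on_imp_differentiable_in_chart[OF Cg assms(5)])
  show "differentiable_in_chart c p (\<lambda>q. \<phi> c q $ i)"
    by (rule C1_on_imp_differentiable_in_chart[OF C\<phi> assms(5)])
  let ?R = "\<lambda>q. det (\<chi> r k. if k = i then \<phi> c q $ r else g c q $ r $ k)"
  have "C1_on ?V (\<lambda>x. ?R (chart_inv c x) / det (g c (chart_inv c x)))"
  proof (rule C1_on_divide)
    show "C1_on ?V (\<lambda>x. ?R (chart_inv c x))"
      using exhaust_3[of i] unfolding det_3
      by (auto intro!: C1_on_add C1_on_diff C1_on_mult Cg C\<phi>)
    show "C1_on ?V (\<lambda>x. det (g c (chart_inv c x)))"
      unfolding det_3 by (intro C1_on_add C1_on_diff C1_on_mult Cg)
    show "det (g c (chart_inv c x)) \<noteq> 0" if "x \<in> ?V" for x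
      using metric_facts(1)[OF assms(2,4) chart_bij(5)[OF assms(1) that]] by simp
  qed
  then have "differentiable_in_chart c p (\<lambda>q. ?R q / det (g c q))"
    by (rule C1_on_imp_differentiable_in_chart) (rule assms(5))
  then show "differentiable_in_chart c p (\<lambda>q. sharp g \<phi> c q $ i)"
  proof (rule differentiable_in_chart_cong[OF assms(1,5)])
    fix q assume q: "q \<in> chart_dom c"
    have "g c q *v sharp g \<phi> c q = \<phi> c q" and "det (g c q) \<noteq> 0"
      using metric_facts[OF assms(2,4) q] by (simp_all add: sharp_def matrix_vector_mul_assoc)
    then show "?R q / det (g c q) = sharp g \<phi> c q $ i"
      using cramer[of "g c q" "sharp g \<phi> c q" "\<phi> c q"] by (simp add: vec_eq_iff)
  qed
qed

text \<open>With \<open>X = \<phi>\<^sup>\<sharp>\<close>, so \<open>\<phi>\<^sub>j = g\<^sub>j\<^sub>l X\<^sup>l\<close>, no inverse of the metric is left: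
  the one in the Christoffel symbols is absorbed when it meets \<open>\<phi>\<close>.  In the bracket of the last sum,
  the first term is the part symmetric in \<open>(j, l)\<close>, which survives contraction with \<open>X\<^sup>j\<close> and gives the
  derivative of \<open>|\<phi>|\<^sup>2\<close>; the last term is the part symmetric in \<open>(i, j)\<close>, which survives the trace.\<close>
lemma cov_deriv_sharp:
  assumes "is_chart M c" "riemannian_metric A g" "one_form A \<phi>" "c \<in> A" "p \<in> chart_dom c"
  shows "cov_deriv g \<phi> c p $ i $ j =
    (\<Sum>l\<in>UNIV. g c p $ j $ l * partial c i (\<lambda>q. sharp g \<phi> c q $ l) p)
    + (\<Sum>l\<in>UNIV. (partial c i (\<lambda>q. g c q $ j $ l) p - partial c j (\<lambda>q. g c q $ i $ l) p
        + partial c l (\<lambda>q. g c q $ i $ j) p) * sharp g \<phi> c p $ l) / 2"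
proof -
  note d = tensor_components_differentiable[OF assms]
  note pm = partial_mult[OF assms(1,5)] and ps = partial_sum3[OF assms(1,5)]
  define T where "T l = partial c i (\<lambda>q. g c q $ j $ l) p + partial c j (\<lambda>q. g c q $ i $ l) p
         - partial c l (\<lambda>q. g c q $ i $ j) p" for l
  have "partial c i (\<lambda>q. \<phi> c q $ j) p
      = partial c i (\<lambda>q. \<Sum>l\<in>UNIV. g c q $ j $ l * sharp g \<phi> c q $ l) p"
    by (rule partial_cong[OF assms(1,5)]) (rule metric_times_sharp[OF assms(2,4)])
  also have "\<dots> = (\<Sum>l\<in>UNIV. g c p $ j $ l * partial c i (\<lambda>q. sharp g \<phi> c q $ l) p
      + partial c i (\<lambda>q. g c q $ j $ l) p * sharp g \<phi> c p $ l)"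
    by (simp only: ps pm d)
  finally have 1: "partial c i (\<lambda>q. \<phi> c q $ j) p = \<dots>" .
  have "(\<Sum>k\<in>UNIV. christoffel g c p k i j * \<phi> c p $ k)
      = (\<Sum>k\<in>UNIV. \<Sum>l\<in>UNIV. matrix_inv (g c p) $ k $ l * T l / 2 * \<phi> c p $ k)"
    by (simp add: christoffel_def T_def sum_distrib_right sum_divide_distrib)
  also have "\<dots> = (\<Sum>k\<in>UNIV. \<Sum>l\<in>UNIV. matrix_inv (g c p) $ l $ k * T l / 2 * \<phi> c p $ k)"
    using inverse_metric_symmetric[OF assms(2,4,5)] by (intro sum.cong) metis+
  also have "\<dots> = (\<Sum>l\<in>UNIV. T l * sharp g \<phi> c p $ l) / 2"
    by (simp add: sharp_def matrix_vector_mult_def sum_3 algebra_simps add_divide_distrib)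
  finally show ?thesis
    unfolding cov_deriv_def by (simp add: 1 T_def sum_3 field_simps)
qed

text \<open>By its definition \<open>\<delta>\<phi>\<close> is \<open>- (1 / r) \<partial>\<^sub>k (r X\<^sup>k)\<close> with \<open>r = sqrt (det g)\<close>.  Jacobi's formula turns the
  derivative of \<open>r\<close> into a trace of derivatives of \<open>g\<close>, and the same trace comes from contracting
  the formula for \<open>\<nabla>\<phi>\<close> with the inverse metric.\<close>
lemma codifferential_eq_neg_trace:
  assumes "is_chart M c" "riemannian_metric A g" "one_form A \<phi>" "c \<in> A" "p \<in> chart_dom c"
  shows "codifferential g \<phi> c p = - metric_trace g (cov_deriv g \<phi>) c p"
proof -
  note d = tensor_components_differentiable[OF assms]
  note m = metric_facts[OF assms(2,4,5)]
  note pm = partial_mult[OF assms(1,5)] and pc = partial_chain[OF assms(1,5)]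
  note det = partial_det[of M c p g, OF assms(1,5) d(1) m(3)]
  define H where "H i j = matrix_inv (g c p) $ i $ j" for i j
  define X where "X i = sharp g \<phi> c p $ i" for i
  define dX where "dX k i = partial c k (\<lambda>q. sharp g \<phi> c q $ i) p" for k i
  define dG where "dG k i j = partial c k (\<lambda>q. g c q $ i $ j) p" for k i j
  \<comment> \<open>twice a summand of \<open>\<nabla>\<phi>\<close>, traceless because it is antisymmetric in \<open>(i, j)\<close>\<close>
  define Y where "Y i j = (\<Sum>l\<in>UNIV. (dG i j l - dG j i l) * X l)" for i j
  define r where "r = sqrt (det (g c p))"
  define t where "t l = (\<Sum>i\<in>UNIV. \<Sum>j\<in>UNIV. H i j * dG l j i)" for l
  have r: "r > 0" "r * r = det (g c p)" using m(1) by (simp_all add: r_def)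
  have H: "H i j = H j i" for i j
    unfolding H_def by (rule inverse_metric_symmetric[OF assms(2,4,5)])
  have HG: "(\<Sum>j\<in>UNIV. H i j * g c p $ j $ l) = (if i = l then 1 else 0)" for i l
    using m(4) unfolding H_def by (simp add: matrix_matrix_mult_def mat_def vec_eq_iff)
  have sq: "(sqrt has_real_derivative 1 / (2 * r)) (at (det (g c p)))"
    using DERIV_real_sqrt[OF m(1)] by (simp add: r_def field_simps)
  have dr: "differentiable_in_chart c p (\<lambda>q. sqrt (det (g c q)))"
    "partial c l (\<lambda>q. sqrt (det (g c q))) p = r * t l / 2" for l
  proof -
    have "partial c l (\<lambda>q. sqrt (det (g c q))) p = 1 / (2 * r) * (r * r * t l)"
      by (simp only: pc[OF det(1) sq] det(2) r t_def H_def dG_def)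
    then show "partial c l (\<lambda>q. sqrt (det (g c q))) p = r * t l / 2" using r(1) by simp
  qed (rule pc[OF det(1) sq])
  have "partial c k (\<lambda>q. sqrt (det (g c q)) * sharp g \<phi> c q $ k) p
      = r * dX k k + r * t k / 2 * X k" for k
    by (simp only: pm dr d r_def[symmetric] X_def dX_def)
  moreover have "hodge1 g \<phi> c q $ 2 $ 3 = sqrt (det (g c q)) * sharp g \<phi> c q $ 1"
        "hodge1 g \<phi> c q $ 3 $ 1 = sqrt (det (g c q)) * sharp g \<phi> c q $ 2"
        "hodge1 g \<phi> c q $ 1 $ 2 = sqrt (det (g c q)) * sharp g \<phi> c q $ 3" for q
    by (simp_all add: hodge1_def det_3 axis_def)
  ultimately have "ext_deriv2 (hodge1 g \<phi>) c p = (\<Sum>k\<in>UNIV. r * dX k k + r * t k / 2 * X k)"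
    by (simp add: ext_deriv2_def sum_3)
  then have L: "codifferential g \<phi> c p = - (\<Sum>k\<in>UNIV. dX k k + t k / 2 * X k)"
    using r(1) by (simp add: codifferential_def hodge3_def r_def[symmetric] sum_3 field_simps)
  have "metric_trace g (cov_deriv g \<phi>) c p
      = (\<Sum>i\<in>UNIV. \<Sum>j\<in>UNIV. H i j * ((\<Sum>l\<in>UNIV. g c p $ j $ l * dX i l)
          + (\<Sum>l\<in>UNIV. (dG i j l - dG j i l + dG l i j) * X l) / 2))"
    unfolding metric_trace_sum cov_deriv_sharp[OF assms] H_def dG_def X_def dX_def ..
  also have "\<dots> = (\<Sum>i\<in>UNIV. \<Sum>j\<in>UNIV. H i j * (\<Sum>l\<in>UNIV. g c p $ j $ l * dX i l)
          + H i j * Y i j / 2 + H i j * (\<Sum>l\<in>UNIV. dG l i j * X l) / 2)"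
    unfolding Y_def
    by (intro sum.cong refl) (simp add: algebra_simps sum.distrib sum_subtractf add_divide_distrib diff_divide_distrib)
  also have "\<dots> = (\<Sum>i\<in>UNIV. \<Sum>j\<in>UNIV. H i j * (\<Sum>l\<in>UNIV. g c p $ j $ l * dX i l))
      + (\<Sum>i\<in>UNIV. \<Sum>j\<in>UNIV. H i j * Y i j) / 2
      + (\<Sum>i\<in>UNIV. \<Sum>j\<in>UNIV. H i j * (\<Sum>l\<in>UNIV. dG l i j * X l)) / 2"
    by (simp add: sum.distrib sum_divide_distrib)
  also have "(\<Sum>i\<in>UNIV. \<Sum>j\<in>UNIV. H i j * Y i j) = 0"
    by (simp add: sum_3 H[of 2 1] H[of 3 1] H[of 3 2] Y_def algebra_simps)
  also have "(\<Sum>i\<in>UNIV. \<Sum>j\<in>UNIV. H i j * (\<Sum>l\<in>UNIV. g c p $ j $ l * dX i l))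
      = (\<Sum>i\<in>UNIV. \<Sum>l\<in>UNIV. (\<Sum>j\<in>UNIV. H i j * g c p $ j $ l) * dX i l)"
    by (simp add: sum_3 algebra_simps)
  also have "(\<Sum>i\<in>UNIV. \<Sum>j\<in>UNIV. H i j * (\<Sum>l\<in>UNIV. dG l i j * X l))
      = (\<Sum>l\<in>UNIV. (\<Sum>i\<in>UNIV. \<Sum>j\<in>UNIV. H i j * dG l i j) * X l)"
    by (simp add: sum_3 algebra_simps)
  also have "(\<Sum>i\<in>UNIV. \<Sum>l\<in>UNIV. (\<Sum>j\<in>UNIV. H i j * g c p $ j $ l) * dX i l) + 0 / 2
      + (\<Sum>l\<in>UNIV. (\<Sum>i\<in>UNIV. \<Sum>j\<in>UNIV. H i j * dG l i j) * X l) / 2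
      = (\<Sum>k\<in>UNIV. dX k k + t k / 2 * X k)"
  proof -
    have "(\<Sum>i\<in>UNIV. \<Sum>j\<in>UNIV. H i j * dG l i j) = t l" for l
      unfolding t_def by (subst sum.swap) (simp only: H)
    then show ?thesis
      by (simp add: HG sum.distrib sum_divide_distrib if_distrib[of "\<lambda>x. x * _"] cong: if_cong)
  qed
  finally show ?thesis using L by simp
qed

text \<open>Metric compatibility of the connection, in the form \<open>d|\<phi>|\<^sup>2 = 2 (\<nabla>\<phi>)(-, \<phi>\<^sup>\<sharp>)\<close>.\<close>
lemma partial_form_inner_self:
  assumes "is_chart M c" "riemannian_metric A g" "one_form A \<phi>" "c \<in> A" "p \<in> chart_dom c"
  shows "differentiable_in_chart c p (form_inner g \<phi> \<phi> c)"
    and "partial c k (form_inner g \<phi> \<phi> c) p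
      = 2 * (\<Sum>j\<in>UNIV. cov_deriv g \<phi> c p $ k $ j * sharp g \<phi> c p $ j)"
proof -
  note d = tensor_components_differentiable[OF assms]
  note m = metric_facts[OF assms(2,4,5)]
  note pm = partial_mult[OF assms(1,5)] and ps = partial_sum3[OF assms(1,5)]
  let ?w = "\<lambda>q. \<Sum>j\<in>UNIV. \<Sum>l\<in>UNIV. g c q $ j $ l * (sharp g \<phi> c q $ l * sharp g \<phi> c q $ j)"
  define X where "X i = sharp g \<phi> c p $ i" for i
  define dX where "dX k i = partial c k (\<lambda>q. sharp g \<phi> c q $ i) p" for k i
  define dG where "dG k i j = partial c k (\<lambda>q. g c q $ i $ j) p" for k i j
  have w: "?w q = form_inner g \<phi> \<phi> c q" if "q \<in> chart_dom c" for q
    unfolding form_inner_def inner_vec_def inner_real_def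
    by (subst (4) metric_times_sharp[OF assms(2,4) that]) (simp add: sum_distrib_right mult.assoc)
  have dw: "differentiable_in_chart c p ?w" by (intro ps(1) pm(1) d)
  show "differentiable_in_chart c p (form_inner g \<phi> \<phi> c)"
    by (rule differentiable_in_chart_cong[OF assms(1,5) dw w])
  have "partial c k (form_inner g \<phi> \<phi> c) p = partial c k ?w p"
    by (rule partial_cong[OF assms(1,5) w[symmetric]])
  also have "\<dots> = (\<Sum>j\<in>UNIV. \<Sum>l\<in>UNIV. g c p $ j $ l * (X l * dX k j + dX k l * X j)
      + dG k j l * (X l * X j))"
    by (simp only: ps pm d X_def dX_def dG_def)
  also have "\<dots> = 2 * (\<Sum>j\<in>UNIV. ((\<Sum>l\<in>UNIV. g c p $ j $ l * dX k l)
          + (\<Sum>l\<in>UNIV. (dG k j l - dG j k l + dG l k j) * X l) / 2) * X j)"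
    by (simp add: sum_3 m(2)[of 2 1] m(2)[of 3 1] m(2)[of 3 2] algebra_simps
        add_divide_distrib diff_divide_distrib)
  finally show "partial c k (form_inner g \<phi> \<phi> c) p
      = 2 * (\<Sum>j\<in>UNIV. cov_deriv g \<phi> c p $ k $ j * sharp g \<phi> c p $ j)"
    unfolding cov_deriv_sharp[OF assms] X_def dX_def dG_def .
qed

section \<open>Functions whose differential is annihilated by a polynomial\<close>
lemma locally_constant_imp_constant:
  assumes conn: "connected_space M"
    and loc: "\<And>p. p \<in> topspace M \<Longrightarrow> \<exists>U. openin M U \<and> p \<in> U \<and> (\<forall>q\<in>U. f q = f p)"
  shows "\<exists>a. \<forall>p\<in>topspace M. f p = a"
proof (cases "topspace M = {}")
  case False
  then obtain r where r: "r \<in> topspace M" by blast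
  have op: "openin M {p \<in> topspace M. f p \<in> B}" for B
    unfolding openin_subopen[of M "{p \<in> topspace M. f p \<in> B}"]
  proof (intro ballI)
    fix p assume p: "p \<in> {p \<in> topspace M. f p \<in> B}"
    then have "p \<in> topspace M" by blast
    from loc[OF this] obtain U where U: "openin M U" "p \<in> U" "\<And>q. q \<in> U \<Longrightarrow> f q = f p"
      by metis
    have "U \<subseteq> {p \<in> topspace M. f p \<in> B}"
    proof
      fix q assume q: "q \<in> U"
      have "q \<in> topspace M" using q openin_subset[OF U(1)] by blast
      moreover have "f q \<in> B" unfolding U(3)[OF q] using p by blast
      ultimately show "q \<in> {p \<in> topspace M. f p \<in> B}" by blast
    qed
    then show "\<exists>T. openin M T \<and> p \<in> T \<and> T \<subseteq> {p \<in> topspace M. f p \<in> B}"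
      using U(1,2) by blast
  qed
  define E where "E = {p \<in> topspace M. f p \<in> {f r}}"
  have "topspace M - E = {p \<in> topspace M. f p \<in> - {f r}}" unfolding E_def by blast
  then have "openin M (topspace M - E)" by (simp only: op)
  then have "closedin M E" unfolding closedin_def E_def by blast
  moreover have "openin M E" unfolding E_def by (rule op)
  ultimately have "E = {} \<or> E = topspace M" using conn connected_space_clopen_in by metis
  then have "E = topspace M" using r by (auto simp: E_def)
  then show ?thesis unfolding E_def by (intro exI[of _ "f r"]) blast
qed simp

text \<open>Since \<open>d(q(f)\<^sup>2) = 2 q'(f) q(f) df = 0\<close>, the function \<open>q(f)\<^sup>2\<close> is constant on every coordinate ball.
  There \<open>f\<close> takes its values among the finitely many roots of a nonzero polynomial, and it is constant because
  the ball is connected.  Squaring \<open>q\<close> replaces the choice of an antiderivative of \<open>q\<close>.\<close>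
lemma constant_if_polynomial_annihilates_differential:
  fixes f :: "'a \<Rightarrow> real"
  assumes atlas: "oriented_atlas M A" and conn: "connected_space M" and f: "smooth_function A f"
    and deg: "degree q > 0"
    and ann: "\<And>c p. c \<in> A \<Longrightarrow> p \<in> chart_dom c \<Longrightarrow> poly q (f p) *\<^sub>R differential f c p = 0"
  shows "\<exists>a. \<forall>p\<in>topspace M. f p = a"
proof (rule locally_constant_imp_constant[OF conn])
  fix p assume "p \<in> topspace M"
  then obtain c where c: "c \<in> A" "p \<in> chart_dom c" using atlas unfolding oriented_atlas_def by blast
  have ch: "is_chart M c" using atlas c by (simp add: oriented_atlas_def)
  define V where "V = chart_map c ` chart_dom c"
  note ci = chart_bij[OF ch, folded V_def]
  have V: "open V" using ch by (simp add: is_chart_def V_def)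
  have pV: "chart_map c p \<in> V" using c by (simp add: V_def)
  then obtain e where e: "e > 0" "ball (chart_map c p) e \<subseteq> V" using V openE by blast
  define B where "B = ball (chart_map c p) e"
  have B: "chart_map c p \<in> B" "open B" "convex B" "B \<subseteq> V" using e by (auto simp: B_def)
  define F where "F x = f (chart_inv c x)" for x
  have C1: "C1_on V F"
    using smooth_in_chart_component_C1_on[OF _ bounded_linear_ident, of c f] f c(1)
    unfolding smooth_function_def V_def F_def[abs_def] by blast
  then obtain D where D: "\<And>x. x \<in> V \<Longrightarrow> (F has_derivative (\<lambda>h. D x \<bullet> h)) (at x)"
    unfolding C1_on_def by metis
  have qD: "poly q (F x) *\<^sub>R D x = 0" if x: "x \<in> V" for x
  proof -
    have "((\<lambda>x. f (chart_inv c x)) has_derivative (\<lambda>h. D x \<bullet> h))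
        (at (chart_map c (chart_inv c x)))"
      using D[OF x] unfolding F_def[abs_def] ci(4)[OF x] .
    from partial_eqI[OF this] have "differential f c (chart_inv c x) = D x"
      by (simp add: differential_def inner_axis vec_eq_iff)
    then show ?thesis using ann[OF c(1) ci(5)[OF x]] by (simp add: F_def)
  qed
  have zero: "((\<lambda>x. poly (q * q) (F x)) has_derivative (\<lambda>h. 0)) (at x within B)" if x: "x \<in> B" for x
  proof -
    have xV: "x \<in> V" using x B by blast
    have "((\<lambda>x. poly (q * q) (F x)) has_derivative (\<lambda>h. poly (pderiv (q * q)) (F x) * (D x \<bullet> h))) (at x)"
      using has_derivative_compose[OF D[OF xV] poly_DERIV[of "q * q" "F x", unfolded has_field_derivative_def]] .
    moreover have "poly (pderiv (q * q)) (F x) * (D x \<bullet> h) = 0" for h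
      using arg_cong[OF qD[OF xV], of "\<lambda>v. v \<bullet> h"] by (auto simp: pderiv_mult)
    ultimately show ?thesis by (simp add: has_derivative_at_withinI)
  qed
  have "\<exists>a. \<forall>x\<in>B. poly (q * q) (F x) = a"
    by (rule has_derivative_zero_constant[OF B(3)]) (rule zero)
  then obtain a where a: "\<And>x. x \<in> B \<Longrightarrow> poly (q * q) (F x) = a" by blast
  have "F ` B \<subseteq> {t. poly (q * q - [:a:]) t = 0}" using a by auto
  moreover have "q * q - [:a:] \<noteq> 0"
  proof
    assume "q * q - [:a:] = 0"
    then have "degree (q * q) = degree [:a:]" by simp
    moreover have "q \<noteq> 0" using deg by auto
    ultimately show False using deg by (simp add: degree_mult_eq)
  qed
  ultimately have "finite (F ` B)" using poly_roots_finite finite_subset by blast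
  moreover have "connected (F ` B)"
    by (intro connected_continuous_image convex_connected B(3)
        continuous_on_subset[OF C1_on_imp_continuous_on[OF C1] B(4)])
  ultimately obtain b where "F ` B \<subseteq> {b}" using connected_finite_iff_sing[of "F ` B"] by auto
  then have FB: "F x = b" if "x \<in> B" for x using that by blast
  define U where "U = {q \<in> chart_dom c. chart_map c q \<in> B}"
  have "openin M U"
  proof -
    have "continuous_map (subtopology M (chart_dom c)) (top_of_set V) (chart_map c)"
      using ch homeomorphic_imp_continuous_map by (auto simp: is_chart_def V_def)
    moreover have "openin (top_of_set V) B" using B by (intro open_subset)
    ultimately have "openin (subtopology M (chart_dom c))
        {q \<in> topspace (subtopology M (chart_dom c)). chart_map c q \<in> B}"
      by (rule openin_continuous_map_preimage)
    moreover have "topspace (subtopology M (chart_dom c)) = chart_dom c" using ci(2) by auto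
    ultimately show ?thesis
      using ch openin_trans_full unfolding U_def is_chart_def by metis
  qed
  moreover have fU: "f q = b" if "q \<in> U" for q
    using that FB[of "chart_map c q"] ci(3)[of q] by (simp add: U_def F_def)
  moreover have pU: "p \<in> U" using c B by (simp add: U_def)
  moreover have "\<forall>q\<in>U. f q = f p" using fU fU[OF pU] by simp
  ultimately show "\<exists>U. openin M U \<and> p \<in> U \<and> (\<forall>q\<in>U. f q = f p)" by blast
qed

section \<open>Einstein solitons\<close>

text \<open>As a polynomial in \<open>y = f\<^sup>2\<close> this is \<open>\<Lambda> - y / 2 + \<kappa> (y - 2\<Lambda>)\<^sup>2 / 8\<close>, the part without derivatives of
  the coefficient of \<open>g\<close> in the soliton equation once \<open>Ric = \<Lambda> g\<close> is inserted.\<close>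
definition einstein_potential :: "real \<Rightarrow> real \<Rightarrow> real poly" where
  "einstein_potential \<kappa> \<Lambda> = [:\<Lambda> + \<kappa> * \<Lambda>\<^sup>2 / 2, - 1 / 2 - \<kappa> * \<Lambda> / 2, \<kappa> / 8:]"

text \<open>The value of \<open>(2 + 3\<kappa>y) |\<phi>|\<^sup>2\<close> on an Einstein soliton, as a polynomial in \<open>y = f\<^sup>2\<close>.\<close>
definition trace_polynomial :: "real \<Rightarrow> real \<Rightarrow> real poly" where
  "trace_polynomial \<kappa> \<Lambda> = [:3 * \<Lambda>, 1 / 2:] - smult 9 (einstein_potential \<kappa> \<Lambda>)"

text \<open>For \<open>Ric = \<Lambda> g\<close> the Ricci endomorphism is a multiple of the identity, so the commutator vanishes and
  all curvature terms become multiples of \<open>g\<close>; the equation \<open>df = f \<phi>\<close> replaces \<open>df\<close> by \<open>\<phi>\<close>.\<close>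
lemma einstein_soliton_reduction:
  assumes sol: "heterotic_soliton A \<kappa> g \<phi> f" and c: "c \<in> A" "p \<in> chart_dom c"
    and ric: "ricci g c p = \<Lambda> *\<^sub>R g c p"
  defines "w \<equiv> form_inner g \<phi> \<phi> c p"
  shows "cov_deriv g \<phi> c p =
      - ((poly (einstein_potential \<kappa> \<Lambda>) ((f p)\<^sup>2) + \<kappa> / 4 * (f p)\<^sup>2 * w) *\<^sub>R g c p)
      - (\<kappa> / 4 * (f p)\<^sup>2) *\<^sub>R tensor_square \<phi> c p"
    and "3 * \<Lambda> = 3 * codifferential g \<phi> c p + 2 * w - (f p)\<^sup>2 / 2"
proof -
  have g: "riemannian_metric A g" using sol by (simp add: heterotic_soliton_def)
  note m = metric_facts[OF g c]
  have endo: "endo_of g (ricci g) c p = \<Lambda> *\<^sub>R mat 1"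
    by (simp add: endo_of_def ric transpose_scalar m(5) m(4) scalar_matrix_assoc[symmetric] matrix_scalar_ac)
  have s: "scalar_curvature g c p = 3 * \<Lambda>"
    by (simp add: scalar_curvature_def metric_trace_def endo trace_def mat_def)
  have comp: "form_comp g (ricci g) c p = \<Lambda>\<^sup>2 *\<^sub>R g c p"
    by (simp add: form_comp_def endo transpose_scalar transpose_mat scalar_matrix_assoc[symmetric] matrix_scalar_ac
        power2_eq_square)
  have tr: "metric_trace g (form_comp g (ricci g)) c p = 3 * \<Lambda>\<^sup>2"
    by (simp add: metric_trace_def endo_of_def comp transpose_scalar m(5) m(4) scalar_matrix_assoc[symmetric]
        matrix_scalar_ac trace_def mat_def)
  have comm: "form_commutator g (hodge1 g (differential f)) (ricci g) c p = 0"
  proof -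
    have "E ** endo_of g (ricci g) c p - endo_of g (ricci g) c p ** E = 0" for E
      by (simp add: endo matrix_scalar_ac scalar_matrix_assoc[symmetric])
    then show ?thesis
      by (simp add: form_commutator_def form_of_endo_def)
         (simp add: vec_eq_iff transpose_def matrix_matrix_mult_def)
  qed
  from sol c have eq: "- \<kappa> *\<^sub>R form_comp g (ricci g) c p
          + (1 + \<kappa> * (3 * \<Lambda>) - \<kappa> / 2 * (f p)\<^sup>2) *\<^sub>R ricci g c p
          + (\<kappa> * metric_trace g (form_comp g (ricci g)) c p - \<kappa> / 2 * (3 * \<Lambda>)\<^sup>2
             + \<kappa> / 4 * form_inner g (differential f) (differential f) c p
             - 1 / 2 * (f p)\<^sup>2 + \<kappa> / 8 * (f p) ^ 4) *\<^sub>R g c p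
          + (\<kappa> / 2) *\<^sub>R form_commutator g (hodge1 g (differential f)) (ricci g) c p
          + (\<kappa> / 4) *\<^sub>R tensor_square (differential f) c p
          + cov_deriv g \<phi> c p = 0"
    and df: "differential f c p = f p *\<^sub>R \<phi> c p"
    and tr3: "3 * \<Lambda> = 3 * codifferential g \<phi> c p + 2 * w - 1 / 2 * (f p)\<^sup>2"
    unfolding heterotic_soliton_def Let_def w_def s[symmetric] by metis+
  have inner: "form_inner g (differential f) (differential f) c p = (f p)\<^sup>2 * w"
    by (simp add: form_inner_def sharp_def df w_def matrix_vector_mult_scaleR power2_eq_square)
  have sq: "tensor_square (differential f) c p = (f p)\<^sup>2 *\<^sub>R tensor_square \<phi> c p"
    by (simp add: tensor_square_def df vec_eq_iff power2_eq_square)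
  have coeff: "- \<kappa> * \<Lambda>\<^sup>2 + (1 + \<kappa> * (3 * \<Lambda>) - \<kappa> / 2 * (f p)\<^sup>2) * \<Lambda>
        + (\<kappa> * (3 * \<Lambda>\<^sup>2) - \<kappa> / 2 * (3 * \<Lambda>)\<^sup>2 + \<kappa> / 4 * ((f p)\<^sup>2 * w)
             - 1 / 2 * (f p)\<^sup>2 + \<kappa> / 8 * (f p) ^ 4)
      = poly (einstein_potential \<kappa> \<Lambda>) ((f p)\<^sup>2) + \<kappa> / 4 * (f p)\<^sup>2 * w"
    by (simp add: einstein_potential_def power2_eq_square power4_eq_xxxx field_simps)
  have combine: "C = - ((a * b + d * e + h) *\<^sub>R G) - (k * m) *\<^sub>R T"
    if "a *\<^sub>R (b *\<^sub>R G) + d *\<^sub>R (e *\<^sub>R G) + h *\<^sub>R G + l *\<^sub>R 0 + k *\<^sub>R (m *\<^sub>R T) + C = 0"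
    for a b d e h k l m :: real and C G T :: "real^3^3"
  proof -
    have "(a * b + d * e + h) *\<^sub>R G + (k * m) *\<^sub>R T + C = 0"
      using that by (simp add: scaleR_left_distrib)
    from minus_unique[OF this] show ?thesis by simp
  qed
  show "cov_deriv g \<phi> c p =
      - ((poly (einstein_potential \<kappa> \<Lambda>) ((f p)\<^sup>2) + \<kappa> / 4 * (f p)\<^sup>2 * w) *\<^sub>R g c p)
      - (\<kappa> / 4 * (f p)\<^sup>2) *\<^sub>R tensor_square \<phi> c p"
    using eq unfolding coeff[symmetric] comp tr comm ric inner sq by (rule combine)
  show "3 * \<Lambda> = 3 * codifferential g \<phi> c p + 2 * w - (f p)\<^sup>2 / 2" using tr3 by simp
qed

text \<open>The trace of the first soliton equation and the scalar equation both compute \<open>\<delta>\<phi>\<close>.  Comparing them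
  leaves no derivatives of \<open>\<phi>\<close>, so \<open>|\<phi>|\<^sup>2\<close> is a rational function of \<open>f\<^sup>2\<close>.\<close>
lemma einstein_soliton_norm:
  assumes chart: "is_chart M c" and sol: "heterotic_soliton A \<kappa> g \<phi> f" and c: "c \<in> A" "p \<in> chart_dom c"
    and ric: "ricci g c p = \<Lambda> *\<^sub>R g c p"
  shows "(2 + 3 * \<kappa> * (f p)\<^sup>2) * form_inner g \<phi> \<phi> c p = poly (trace_polynomial \<kappa> \<Lambda>) ((f p)\<^sup>2)"
proof -
  have g: "riemannian_metric A g" and \<phi>: "one_form A \<phi>"
    using sol by (simp_all add: heterotic_soliton_def closed_one_form_def)
  note red = einstein_soliton_reduction[OF sol c ric]
  define H where "H i j = matrix_inv (g c p) $ i $ j" for i j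
  define w where "w = form_inner g \<phi> \<phi> c p"
  define \<Phi> where "\<Phi> = poly (einstein_potential \<kappa> \<Lambda>) ((f p)\<^sup>2)"
  have Hg: "(\<Sum>i\<in>UNIV. \<Sum>j\<in>UNIV. H i j * g c p $ i $ j) = 3"
  proof -
    have "metric_trace g g c p = 3"
      using metric_facts[OF g c] by (simp add: metric_trace_def endo_of_def trace_def mat_def)
    then show ?thesis by (simp add: metric_trace_sum H_def)
  qed
  have Hw: "(\<Sum>i\<in>UNIV. \<Sum>j\<in>UNIV. H i j * tensor_square \<phi> c p $ i $ j) = w"
    by (simp add: w_def form_inner_def sharp_def inner_vec_def matrix_vector_mult_def H_def
        tensor_square_def sum_distrib_left mult_ac)
  have "metric_trace g (cov_deriv g \<phi>) c p = - (\<Phi> + \<kappa> / 4 * (f p)\<^sup>2 * w)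
        * (\<Sum>i\<in>UNIV. \<Sum>j\<in>UNIV. H i j * g c p $ i $ j)
      - \<kappa> / 4 * (f p)\<^sup>2 * (\<Sum>i\<in>UNIV. \<Sum>j\<in>UNIV. H i j * tensor_square \<phi> c p $ i $ j)"
    unfolding metric_trace_sum red(1) H_def w_def \<Phi>_def
    by (simp add: sum_3 algebra_simps)
  then have "codifferential g \<phi> c p = 3 * \<Phi> + \<kappa> * (f p)\<^sup>2 * w"
    unfolding codifferential_eq_neg_trace[OF chart g \<phi> c] Hg Hw by (simp add: algebra_simps)
  then show ?thesis
    using red(2) unfolding w_def[symmetric] by (simp add: trace_polynomial_def \<Phi>_def algebra_simps)
qed

text \<open>Differentiate \<open>D(y) |\<phi>|\<^sup>2 = N(y)\<close>, use \<open>dy = 2y \<phi>\<close> and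
  \<open>d|\<phi>|\<^sup>2 = - (2\<Phi>(y) + \<kappa>y |\<phi>|\<^sup>2) \<phi>\<close> with \<open>\<Phi>\<close> the Einstein potential, and multiply by \<open>D(y)\<close> to
  eliminate \<open>|\<phi>|\<^sup>2\<close>: what remains is this polynomial in \<open>y\<close> times \<open>\<phi>\<close>.\<close>
definition dilaton_polynomial :: "real \<Rightarrow> real \<Rightarrow> real poly" where
  "dilaton_polynomial \<kappa> \<Lambda> =
     (let y = [:0, 1:]; D = [:2, 3 * \<kappa>:]; N = trace_polynomial \<kappa> \<Lambda> in
       smult (6 * \<kappa>) (y * N) - smult 2 (D * D * einstein_potential \<kappa> \<Lambda>) - smult \<kappa> (y * D * N)
       - smult 2 (y * D * pderiv N))"

text \<open>Only \<open>D\<^sup>2 \<Phi>\<close> and \<open>y D N\<close> reach degree four.  They contribute \<open>- 9\<kappa>\<^sup>3 / 4\<close> and \<open>27\<kappa>\<^sup>3 / 8\<close> to the leading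
  coefficient, which therefore does not cancel.\<close>
lemma degree_dilaton_polynomial:
  assumes "\<kappa> > 0"
  shows "degree (dilaton_polynomial \<kappa> \<Lambda>) > 0"
proof -
  have "coeff (dilaton_polynomial \<kappa> \<Lambda>) 4 = 9 * \<kappa> ^ 3 / 8"
    by (simp add: dilaton_polynomial_def trace_polynomial_def einstein_potential_def Let_def
        numeral_eq_Suc pderiv_pCons algebra_simps)
  then have "coeff (dilaton_polynomial \<kappa> \<Lambda>) 4 \<noteq> 0" using assms by (metis divide_eq_0_iff
        less_irrefl mult_eq_0_iff power_eq_0_iff zero_neq_numeral)
  from le_degree[OF this] show ?thesis by simp
qed

lemma dilaton_polynomial_annihilates_form:
  assumes chart: "is_chart M c" and sol: "heterotic_soliton A \<kappa> g \<phi> f" and c: "c \<in> A" "p \<in> chart_dom c"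
    and ric: "\<And>q. q \<in> chart_dom c \<Longrightarrow> ricci g c q = \<Lambda> *\<^sub>R g c q"
  shows "poly (dilaton_polynomial \<kappa> \<Lambda>) ((f p)\<^sup>2) *\<^sub>R \<phi> c p = 0"
proof -
  have g: "riemannian_metric A g" and \<phi>: "one_form A \<phi>" and f: "smooth_in_chart c f"
    using sol c by (simp_all add: heterotic_soliton_def closed_one_form_def smooth_function_def)
  note pm = partial_mult[OF chart c(2)] and pa = partial_add[OF chart c(2)]
    and pk = partial_const[OF chart c(2)] and pc = partial_chain[OF chart c(2)]
  define y where "y = (f p)\<^sup>2"
  define w where "w = form_inner g \<phi> \<phi> c p"
  define \<Phi> where "\<Phi> = poly (einstein_potential \<kappa> \<Lambda>) y"
  define N where "N = trace_polynomial \<kappa> \<Lambda>"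
  define D where "D = 2 + 3 * \<kappa> * y"
  have df: "differentiable_in_chart c p f"
    using C1_on_imp_differentiable_in_chart[OF smooth_in_chart_component_C1_on[OF f bounded_linear_ident] c(2)] .
  have Dw: "D * w = poly N y"
    using einstein_soliton_norm[OF chart sol c ric[OF c(2)]] by (simp add: D_def w_def N_def y_def)
  have "poly (dilaton_polynomial \<kappa> \<Lambda>) y * \<phi> c p $ k = 0" for k
  proof -
    have "differential f c p = f p *\<^sub>R \<phi> c p"
      using sol c unfolding heterotic_soliton_def Let_def by metis
    then have fk: "partial c k f p = f p * \<phi> c p $ k"
      by (simp add: differential_def vec_eq_iff)
    have "((\<lambda>t. t\<^sup>2) has_real_derivative 2 * f p) (at (f p))"
      by (auto intro!: derivative_eq_intros)
    note y2 = pc[OF df this]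
    have dy: "differentiable_in_chart c p (\<lambda>q. (f q)\<^sup>2)"
      "partial c k (\<lambda>q. (f q)\<^sup>2) p = 2 * y * \<phi> c p $ k"
      unfolding y2(2) by (fact y2(1)) (simp add: fk y_def power2_eq_square)
    note w = partial_form_inner_self[OF chart g \<phi> c]
    have dw: "partial c k (form_inner g \<phi> \<phi> c) p = - (2 * \<Phi> + \<kappa> * y * w) * \<phi> c p $ k"
    proof -
      have "(\<Sum>j\<in>UNIV. cov_deriv g \<phi> c p $ k $ j * sharp g \<phi> c p $ j)
        = - (\<Phi> + \<kappa> / 4 * y * w) * (\<Sum>j\<in>UNIV. g c p $ k $ j * sharp g \<phi> c p $ j)
          - \<kappa> / 4 * y * \<phi> c p $ k * (\<Sum>j\<in>UNIV. \<phi> c p $ j * sharp g \<phi> c p $ j)"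
        unfolding einstein_soliton_reduction(1)[OF sol c ric[OF c(2)]] y_def w_def \<Phi>_def tensor_square_def
        by (simp add: sum_3 algebra_simps)
      moreover have "(\<Sum>j\<in>UNIV. \<phi> c p $ j * sharp g \<phi> c p $ j) = w"
        by (simp add: w_def form_inner_def inner_vec_def)
      ultimately show ?thesis
        unfolding w(2) metric_times_sharp[OF g c, symmetric] by (simp add: algebra_simps)
    qed
    have "partial c k (\<lambda>q. (2 + 3 * \<kappa> * (f q)\<^sup>2) * form_inner g \<phi> \<phi> c q) p
        = partial c k (\<lambda>q. poly N ((f q)\<^sup>2)) p"
      by (rule partial_cong[OF chart c(2)]) (use einstein_soliton_norm[OF chart sol c(1)] ric N_def in auto)
    also have "\<dots> = poly (pderiv N) y * (2 * y * \<phi> c p $ k)"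
      using pc(2)[OF dy(1) poly_DERIV] by (simp only: dy(2) y_def)
    also have "partial c k (\<lambda>q. (2 + 3 * \<kappa> * (f q)\<^sup>2) * form_inner g \<phi> \<phi> c q) p
        = D * (- (2 * \<Phi> + \<kappa> * y * w) * \<phi> c p $ k) + 3 * \<kappa> * (2 * y * \<phi> c p $ k) * w"
      by (simp only: pm pa pk dy w(1) dw) (simp add: D_def y_def w_def)
    finally have "D * (D * (- (2 * \<Phi> + \<kappa> * y * w) * \<phi> c p $ k) + 3 * \<kappa> * (2 * y * \<phi> c p $ k) * w)
        = D * (poly (pderiv N) y * (2 * y * \<phi> c p $ k))" by simp
    then have "(6 * \<kappa> * y * (D * w) - 2 * D * D * \<Phi> - \<kappa> * y * D * (D * w)
        - 2 * y * D * poly (pderiv N) y) * \<phi> c p $ k = 0" by (simp add: algebra_simps)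
    then show ?thesis
      unfolding Dw by (simp add: dilaton_polynomial_def Let_def N_def \<Phi>_def D_def algebra_simps)
  qed
  then show ?thesis by (simp add: vec_eq_iff y_def)
qed

text \<open>The annihilator of \<open>\<phi>\<close> also annihilates \<open>df = f \<phi>\<close>, at zeros of \<open>f\<close> as well.  It is a polynomial in
  \<open>f\<^sup>2\<close>, and composing it with the square makes it a polynomial in \<open>f\<close>.\<close>
theorem theorem4p11:
  fixes M :: "'a topology" and A :: "'a chart set" and \<kappa> :: real
    and g :: "'a bilinear_field" and \<phi> :: "'a covector_field" and f :: "'a \<Rightarrow> real"
  assumes "closed_oriented_three_manifold M A"
    and "connected_space M"
    and "\<kappa> > 0"
    and "heterotic_soliton A \<kappa> g \<phi> f"
    and "einstein A g"
  shows "\<exists>a. \<forall>p\<in>topspace M. f p = a"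
proof -
  have atlas: "oriented_atlas M A"
    using assms(1) by (simp add: closed_oriented_three_manifold_def oriented_three_manifold_def)
  obtain \<Lambda> where ric: "\<And>c p. c \<in> A \<Longrightarrow> p \<in> chart_dom c \<Longrightarrow> ricci g c p = \<Lambda> *\<^sub>R g c p"
    using assms(5) by (auto simp: einstein_def)
  let ?q = "dilaton_polynomial \<kappa> \<Lambda> \<circ>\<^sub>p [:0, 0, 1:]"
  have deg: "degree ?q > 0"
    using degree_dilaton_polynomial[OF assms(3), of \<Lambda>] by (simp add: degree_pcompose)
  have f: "smooth_function A f" using assms(4) by (simp add: heterotic_soliton_def)
  show ?thesis
  proof (rule constant_if_polynomial_annihilates_differential[OF atlas assms(2) f deg])
    fix c p assume c: "c \<in> A" "p \<in> chart_dom c"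
    have "is_chart M c" using atlas c by (simp add: oriented_atlas_def)
    note ann = dilaton_polynomial_annihilates_form[OF this assms(4) c ric[OF c(1)]]
    have "differential f c p = f p *\<^sub>R \<phi> c p"
      using assms(4) c unfolding heterotic_soliton_def Let_def by metis
    moreover have "poly ?q (f p) = poly (dilaton_polynomial \<kappa> \<Lambda>) ((f p)\<^sup>2)"
      by (simp add: poly_pcompose power2_eq_square)
    ultimately show "poly ?q (f p) *\<^sub>R differential f c p = 0"
      using ann by auto
  qed
qed

end
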